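(* Let $n\ge 3$. Every bipartite RAC graph with $n$ vertices has at most $3n-7$ edges.
   Context: A (simple) graph is a RAC (right-angle-crossing) graph if it admits a straight-line drawing in the plane (vertices at distinct points, edges as straight segments not passing through other vertices) in which any two crossing edges cross at a right angle. *)

theory Defs
  imports "HOL-Analysis.Analysis"
begin

definition simple_graph :: "'a set \<Rightarrow> 'a set set \<Rightarrow> bool" where
  "simple_graph V E \<longleftrightarrow> finite V \<and> (\<forall>e\<in>E. e \<subseteq> V \<and> card e = 2)"

definition bipartite :: "'a set \<Rightarrow> 'a set set \<Rightarrow> bool" where
  "bipartite V E \<longleftrightarrow>
     (\<exists>A B. A \<union> B = V \<and> A \<inter> B = {} \<and> (\<forall>e\<in>E. \<exists>a\<in>A. \<exists>b\<in>B. e = {a, b}))"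

text \<open>
  Vertices are placed by \<open>p\<close>; the edge \<open>{u, v}\<close> is drawn as the closed segment from \<open>p u\<close> to \<open>p v\<close>.
\<close>

definition straight_line_drawing ::
    "'a set \<Rightarrow> 'a set set \<Rightarrow> ('a \<Rightarrow> real ^ 2) \<Rightarrow> bool" where
  "straight_line_drawing V E p \<longleftrightarrow>
     inj_on p V \<and>
     (\<forall>u v. {u, v} \<in> E \<longrightarrow> (\<forall>w\<in>V - {u, v}. p w \<notin> closed_segment (p u) (p v)))"

text \<open>
  Two distinct edges cross if they share a point interior to both. In a straight-line drawing
  this excludes edges with a common endvertex, and also collinear overlaps: in either
  degenerate case one edge would pass through an endvertex of the other.
\<close>

definition RAC_drawing :: "'a set \<Rightarrow> 'a set set \<Rightarrow> ('a \<Rightarrow> real ^ 2) \<Rightarrow> bool" where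
  "RAC_drawing V E p \<longleftrightarrow>
     straight_line_drawing V E p \<and>
     (\<forall>a b c d. {a, b} \<in> E \<and> {c, d} \<in> E \<and> {a, b} \<noteq> {c, d} \<and>
        open_segment (p a) (p b) \<inter> open_segment (p c) (p d) \<noteq> {} \<longrightarrow>
        orthogonal (p b - p a) (p d - p c))"

definition RAC_graph :: "'a set \<Rightarrow> 'a set set \<Rightarrow> bool" where
  "RAC_graph V E \<longleftrightarrow> simple_graph V E \<and> (\<exists>p. RAC_drawing V E p)"

end

theory Submission
  imports Defs
begin

text \<open>
  Colour an edge blue if its direction lies in the first quadrant or is horizontal. Orthogonal
  directions have different colours, so no two blue edges cross and no two non-blue edges cross.
  Remove the blue edges that are crossed. What is left is a plane bipartite graph, with at most
  \<open>2n - 4\<close> edges; it remains to see that at most \<open>n - 3\<close> blue edges are crossed.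

  Both bounds come from triangles in a maximal plane straight-line graph on the \<open>n\<close> points.
  With respect to a generic linear functional, a triangle has a middle vertex and lies above or
  below it, and different triangles yield different pairs (middle vertex, side). Since at least
  three pairs are not used, not counting those at the first point, there are at most \<open>2n - 5\<close>
  triangles. A triangle contains at most two edges of a bipartite graph, and a side of an
  edge without a triangle can be charged to an unused pair. If all triangles contain
  at most one crossed blue edge, there are at most \<open>n - 3\<close> of these, because such an edge has
  a triangle on either side.

  To keep two crossed blue edges \<open>uv\<close>, \<open>uw\<close> from lying in one triangle, include in the maximal plane
  graph a maximal set of edges crossing neither each other nor any crossed blue or non-blue edge. One of them
  leaves \<open>u\<close> between \<open>uv\<close> and \<open>uw\<close>: it leads to the first point met in the part of the angle
  cut off by the perpendicular edges that cross \<open>uv\<close> and \<open>uw\<close> nearest to \<open>u\<close>.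
\<close>

text \<open>The colouring by itself splits the graph into two plane bipartite graphs and yields only
  4n - 8. The gain lies in the second class: a plane bipartite graph may have two edges in a
  triangle, the crossed blue edges only one. Right angles serve again at the corner. A blue edge
  that crosses the first perpendicular on uv is parallel to uv, so beyond that perpendicular it only
  moves away from u and cannot hide the nearest point.

  Triangles stand in for bounded faces, so neither Euler's formula nor connectivity enters. All that
  is asked of the maximal plane graph is an empty triangle on each side of an edge where there are
  points. Both bounds on twice the number of edges come out odd, 4n - 7 and 2n - 5, and halving
  supplies the last unit.\<close>

subsection \<open>Affine functions and segments in the plane\<close>

text \<open>The determinant, used as an orientation test: \<open>0 < cr (v - u) (x - u)\<close>
  places x strictly to the left of the line directed from u to v.\<close>

definition cr :: "real^2 \<Rightarrow> real^2 \<Rightarrow> real" where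
  "cr a b = a$1 * b$2 - a$2 * b$1"

lemma cr_simps:
  "cr (a + b) c = cr a c + cr b c" "cr c (a + b) = cr c a + cr c b"
  "cr (a - b) c = cr a c - cr b c" "cr c (a - b) = cr c a - cr c b"
  "cr (k *\<^sub>R a) b = k * cr a b" "cr a (k *\<^sub>R b) = k * cr a b"
  "cr a a = 0" "cr 0 a = 0" "cr a 0 = 0" "cr (- a) b = - cr a b" "cr a (- b) = - cr a b"
  by (simp_all add: cr_def algebra_simps)

lemma cr_commute: "cr b a = - cr a b"
  by (simp add: cr_def algebra_simps)

lemma inner_2: "(x::real^2) \<bullet> y = x$1 * y$1 + x$2 * y$2"
  by (simp add: inner_vec_def sum_2)

text \<open>Cramer's rule; its two quotients become \<open>coord1\<close> and
  \<open>coord2\<close>.\<close>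

lemma cr_basis:
  assumes "cr A B \<noteq> 0"
  shows "y = (cr y B / cr A B) *\<^sub>R A + (cr A y / cr A B) *\<^sub>R B"
proof -
  have "cr A B *\<^sub>R y = cr y B *\<^sub>R A + cr A y *\<^sub>R B"
    by (simp add: vec_eq_iff forall_2 cr_def algebra_simps)
  then have "(1 / cr A B) *\<^sub>R (cr A B *\<^sub>R y) = (1 / cr A B) *\<^sub>R (cr y B *\<^sub>R A + cr A y *\<^sub>R B)"
    by simp
  then show ?thesis
    using assms by (simp add: scaleR_right_distrib)
qed

lemma cr_zero_parallel:
  assumes "cr A x = 0" "A \<noteq> 0"
  shows "\<exists>k. x = k *\<^sub>R A"
proof -
  have eq: "A$1 * x$2 = A$2 * x$1" using assms(1) by (simp add: cr_def)
  have "(A \<bullet> A) * x$1 = (A \<bullet> x) * A$1"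
    using arg_cong[OF eq, of "\<lambda>z. A$2 * z"] by (auto simp: inner_2 algebra_simps)
  moreover have "(A \<bullet> A) * x$2 = (A \<bullet> x) * A$2"
    using arg_cong[OF eq, of "\<lambda>z. A$1 * z"] by (auto simp: inner_2 algebra_simps)
  ultimately have "(A \<bullet> A) *\<^sub>R x = (A \<bullet> x) *\<^sub>R A"
    by (simp add: vec_eq_iff forall_2)
  then have "x = ((A \<bullet> x) / (A \<bullet> A)) *\<^sub>R A"
    using assms(2) by (metis divideR_right divide_inverse_commute inner_eq_zero_iff scaleR_scaleR)
  then show ?thesis by blast
qed

lemma lagrange_2: "(A \<bullet> A) * (B \<bullet> B) - (A \<bullet> B)^2 = (cr A B)^2"
  by (simp add: cr_def inner_2 power2_eq_square algebra_simps)

lemma orthogonal_both_zero: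
  assumes "cr A B \<noteq> 0" "A \<bullet> x = 0" "B \<bullet> x = 0"
  shows "x = 0"
proof -
  have "x \<bullet> x = (cr x B / cr A B) * (A \<bullet> x) + (cr A x / cr A B) * (B \<bullet> x)"
    by (subst (1) cr_basis[OF assms(1), of x]) (simp add: inner_add_left)
  then show ?thesis using assms by simp
qed

text \<open>The parameter is not confined to [0, 1], because \<open>aff_coords\<close> extrapolates
  beyond the two given points.\<close>

definition aff :: "(real^2 \<Rightarrow> real) \<Rightarrow> bool" where
  "aff f \<longleftrightarrow> (\<forall>x y t. f ((1 - t) *\<^sub>R x + t *\<^sub>R y) = (1 - t) * f x + t * f y)"

lemma affD: "aff f \<Longrightarrow> f ((1 - t) *\<^sub>R x + t *\<^sub>R y) = (1 - t) * f x + t * f y"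
  by (simp add: aff_def)

lemma aff_const [intro!]: "aff (\<lambda>y. k)"
  by (simp add: aff_def algebra_simps)

lemma aff_add [intro!]: "aff f \<Longrightarrow> aff g \<Longrightarrow> aff (\<lambda>y. f y + g y)"
  unfolding aff_def by (simp add: distrib_left)

lemma aff_diff [intro!]: "aff f \<Longrightarrow> aff g \<Longrightarrow> aff (\<lambda>y. f y - g y)"
  unfolding aff_def by (simp add: right_diff_distrib)

lemma aff_mult [intro!]: "aff f \<Longrightarrow> aff (\<lambda>y. k * f y)"
  unfolding aff_def by (simp add: distrib_left mult.left_commute)

lemma aff_divide [intro!]: "aff f \<Longrightarrow> aff (\<lambda>y. f y / k)"
  by (simp add: aff_def add_divide_distrib)

lemma aff_uminus [intro!]: "aff f \<Longrightarrow> aff (\<lambda>y. - f y)"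
  unfolding aff_def by simp

lemma aff_cr1 [intro!]: "aff (\<lambda>y. cr (y - p) b)"
  by (simp add: aff_def cr_simps algebra_simps)

lemma aff_cr2 [intro!]: "aff (\<lambda>y. cr a (y - p))"
  by (simp add: aff_def cr_simps algebra_simps)

lemma aff_inner [intro!]: "aff (\<lambda>y. (y - p) \<bullet> b)"
  by (simp add: aff_def inner_diff_left inner_add_left algebra_simps)

text \<open>The constraints describe a convex region containing r but not e. On the way from r to e
  a constraint violated at e vanishes at parameter \<open>\<tau> \<phi>\<close>; the smallest of
  these parameters is where the region is left.\<close>

lemma exit_point:
  assumes "finite \<Phi>" "\<And>\<phi>. \<phi> \<in> \<Phi> \<Longrightarrow> aff \<phi>" "\<And>\<phi>. \<phi> \<in> \<Phi> \<Longrightarrow> 0 \<le> \<phi> r" "\<exists>\<phi>\<in>\<Phi>. \<phi> e < 0"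
  obtains \<phi> t where "\<phi> \<in> \<Phi>" "0 \<le> t" "t < 1" "\<phi> ((1 - t) *\<^sub>R r + t *\<^sub>R e) = 0" "\<phi> e < 0"
    "\<And>\<psi>. \<psi> \<in> \<Phi> \<Longrightarrow> 0 \<le> \<psi> ((1 - t) *\<^sub>R r + t *\<^sub>R e)"
proof -
  define N where "N = {\<phi> \<in> \<Phi>. \<phi> e < 0}"
  define \<tau> where "\<tau> \<phi> = \<phi> r / (\<phi> r - \<phi> e)" for \<phi> :: "real^2 \<Rightarrow> real"
  have N: "finite N" "N \<noteq> {}" using assms by (auto simp: N_def)
  obtain \<phi> where \<phi>: "\<phi> \<in> N" "\<And>\<psi>. \<psi> \<in> N \<Longrightarrow> \<tau> \<phi> \<le> \<tau> \<psi>"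
    using ex_min_if_finite[of "\<tau> ` N"] N by (metis (no_types, lifting) arg_min_if_finite(1) arg_min_least)
  have \<phi>': "\<phi> \<in> \<Phi>" "\<phi> e < 0" "0 \<le> \<phi> r" using \<phi> assms(3) by (auto simp: N_def)
  have t: "0 \<le> \<tau> \<phi>" "\<tau> \<phi> < 1" using \<phi>' by (auto simp: \<tau>_def)
  show thesis
  proof
    show "\<phi> \<in> \<Phi>" "0 \<le> \<tau> \<phi>" "\<tau> \<phi> < 1" "\<phi> e < 0" by (fact \<phi>' t)+
    have "(1 - \<tau> \<phi>) * \<phi> r + \<tau> \<phi> * \<phi> e = \<phi> r - \<tau> \<phi> * (\<phi> r - \<phi> e)"
      by (simp add: algebra_simps)
    also have "\<dots> = 0" using \<phi>' by (simp add: \<tau>_def)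
    finally show "\<phi> ((1 - \<tau> \<phi>) *\<^sub>R r + \<tau> \<phi> *\<^sub>R e) = 0"
      using \<phi>' assms(2) by (simp add: affD)
  next
    fix \<psi> assume \<psi>: "\<psi> \<in> \<Phi>"
    have \<psi>r: "0 \<le> \<psi> r" by (simp add: assms(3) \<psi>)
    have "0 \<le> (1 - \<tau> \<phi>) * \<psi> r + \<tau> \<phi> * \<psi> e"
    proof (cases "\<psi> e < 0")
      case True
      then have "\<tau> \<phi> \<le> \<tau> \<psi>" using \<psi> \<phi> by (simp add: N_def)
      then have "\<tau> \<phi> * (\<psi> r - \<psi> e) \<le> \<psi> r"
        using True \<psi>r by (simp add: \<tau>_def[of \<psi>] pos_le_divide_eq)
      then show ?thesis by (simp add: algebra_simps)
    next
      case False
      then show ?thesis using t \<psi>r by simp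
    qed
    then show "0 \<le> \<psi> ((1 - \<tau> \<phi>) *\<^sub>R r + \<tau> \<phi> *\<^sub>R e)"
      using assms(2) \<psi> by (simp add: affD)
  qed
qed

lemma open_segment_move:
  assumes "r \<in> open_segment c d" "e \<in> {c, d}" "0 \<le> t" "t < 1"
  shows "(1 - t) *\<^sub>R r + t *\<^sub>R e \<in> open_segment c (d::real^2)"
proof -
  obtain s where s: "c \<noteq> d" "0 < s" "s < 1" "r = (1 - s) *\<^sub>R c + s *\<^sub>R d"
    using assms(1) by (auto simp: in_segment)
  consider "e = c" | "e = d" using assms(2) by auto
  then show ?thesis
  proof cases
    case 1
    have "(1 - t) *\<^sub>R r + t *\<^sub>R e = (1 - (1 - t) * s) *\<^sub>R c + ((1 - t) * s) *\<^sub>R d"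
      unfolding s 1 by (simp add: algebra_simps)
    moreover have "0 < (1 - t) * s" "(1 - t) * s < 1"
      using s assms by (auto simp: mult_le_one intro: le_less_trans[OF mult_left_le_one_le[of s "1 - t"]])
    ultimately show ?thesis using s(1) by (auto simp: in_segment)
  next
    case 2
    have eq: "(1 - t) *\<^sub>R r + t *\<^sub>R e = (1 - (1 - (1 - t) * (1 - s))) *\<^sub>R c + (1 - (1 - t) * (1 - s)) *\<^sub>R d"
      unfolding s 2 by (simp add: algebra_simps)
    moreover have "0 < (1 - t) * (1 - s)" "(1 - t) * (1 - s) < 1"
      using s assms by (auto intro: le_less_trans[OF mult_left_le_one_le[of "1 - s" "1 - t"]])
    ultimately show ?thesis using s(1)
      by (simp only: eq in_segment) (metis diff_gt_0_iff_gt diff_less_eq less_add_same_cancel1)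
  qed
qed

lemma aff_open_segment:
  assumes "aff f" "r \<in> open_segment c d"
  obtains t where "0 < t" "t < 1" "f r = (1 - t) * f c + t * f d" "r = (1 - t) *\<^sub>R c + t *\<^sub>R d"
  using assms by (auto simp: in_segment affD)

lemma aff_open_segment_le:
  assumes "aff f" "r \<in> open_segment c d"
  obtains e where "e \<in> {c, d}" "f e \<le> f r"
proof -
  obtain t where t: "0 < t" "t < 1" "f r = (1 - t) * f c + t * f d"
    using aff_open_segment[OF assms] by metis
  have "f c \<le> f r \<or> f d \<le> f r"
  proof (rule ccontr)
    assume "\<not> ?thesis"
    then have "f r < f c" "f r < f d" by auto
    then have "(1 - t) * f r + t * f r < (1 - t) * f c + t * f d"
      using t by (intro add_strict_mono mult_strict_left_mono) auto
    then show False using t by (simp add: algebra_simps)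
  qed
  then show thesis using that by blast
qed

text \<open>A proper average of two values that are not both zero can vanish only if their signs
  differ. Applied to \<open>- f\<close>, this selects the end on the positive side.\<close>

lemma aff_open_segment_zero_neg:
  assumes "aff f" "r \<in> open_segment c d" "f r = 0" "f c \<noteq> 0 \<or> f d \<noteq> 0"
  obtains e where "e \<in> {c, d}" "f e < 0"
proof -
  obtain t where t: "0 < t" "t < 1" "f r = (1 - t) * f c + t * f d"
    using aff_open_segment[OF assms(1,2)] by metis
  have "f c < 0 \<or> f d < 0"
  proof (rule ccontr)
    assume "\<not> ?thesis"
    then have *: "0 \<le> f c" "0 \<le> f d" by auto
    then have "0 \<le> (1 - t) * f c" "0 \<le> t * f d" using t by auto
    with t(3) assms(3) have "(1 - t) * f c = 0" "t * f d = 0" by linarith+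
    then show False using t assms(4) by auto
  qed
  then show thesis using that by blast
qed

text \<open>Parallel segments with a common interior point lie on one line. If neither has an end
  inside the other, they must coincide.\<close>

lemma proper_crossing:
  fixes a b c d :: "real^2"
  assumes "r \<in> open_segment a b" "r \<in> open_segment c d"
    "a \<notin> open_segment c d" "b \<notin> open_segment c d" "c \<notin> open_segment a b" "d \<notin> open_segment a b"
    "{a, b} \<noteq> {c, d}"
  shows "cr (b - a) (d - c) \<noteq> 0"
proof
  assume 0: "cr (b - a) (d - c) = 0"
  obtain t where t: "a \<noteq> b" "0 < t" "t < 1" "r = (1 - t) *\<^sub>R a + t *\<^sub>R b"
    using assms(1) by (auto simp: in_segment)
  obtain s where s: "c \<noteq> d" "0 < s" "s < 1" "r = (1 - s) *\<^sub>R c + s *\<^sub>R d"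
    using assms(2) by (auto simp: in_segment)
  obtain k where k: "d - c = k *\<^sub>R (b - a)" using cr_zero_parallel[OF 0] t by auto
  have k0: "k \<noteq> 0" using k s(1) by auto
  have c: "c = a + (t - s * k) *\<^sub>R (b - a)"
  proof -
    have "c = r - s *\<^sub>R (d - c)" unfolding s(4) by (simp add: algebra_simps)
    also have "\<dots> = a + (t - s * k) *\<^sub>R (b - a)" unfolding k t(4) by (simp add: algebra_simps)
    finally show ?thesis .
  qed
  have d: "d = a + (t + (1 - s) * k) *\<^sub>R (b - a)"
    using k c by (simp add: algebra_simps)
  \<comment> \<open>The positions of c and d on the line through a and b, with a at 0 and b at 1.
    The common point r, at position t, lies strictly between them.\<close>
  define C where "C = t - s * k"
  define E where "E = t + (1 - s) * k"
  have on: "a + x *\<^sub>R (b - a) \<in> open_segment a b" if "0 < x" "x < 1" for x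
    using that t(1) by (auto simp: in_segment intro!: exI[of _ x] simp: algebra_simps)
  have cd: "a + x *\<^sub>R (b - a) \<in> open_segment c d" if "C < x \<and> x < E \<or> E < x \<and> x < C" for x
  proof -
    have EC: "E - C = k" by (simp add: E_def C_def algebra_simps)
    define y where "y = (x - C) / k"
    have y: "0 < y" "y < 1"
      using that unfolding atomize_conj
    proof
      assume "C < x \<and> x < E"
      then show "0 < y \<and> y < 1" by (simp add: y_def flip: EC)
    next
      assume "E < x \<and> x < C"
      then show "0 < y \<and> y < 1"
        by (simp add: y_def divide_less_eq zero_less_divide_iff flip: EC)
    qed
    have "a + x *\<^sub>R (b - a) = (1 - y) *\<^sub>R c + y *\<^sub>R d"
    proof -
      have "(1 - y) *\<^sub>R c + y *\<^sub>R d = c + y *\<^sub>R (d - c)" by (simp add: algebra_simps)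
      also have "\<dots> = a + (C + y * k) *\<^sub>R (b - a)" unfolding k by (subst c) (simp add: C_def algebra_simps)
      also have "C + y * k = x" using k0 by (simp add: y_def)
      finally show ?thesis by simp
    qed
    then show ?thesis using y s(1) by (auto simp: in_segment)
  qed
  have C: "\<not> (0 < C \<and> C < 1)" "\<not> (0 < E \<and> E < 1)"
    using on[of C] on[of E] assms(5,6) c d by (auto simp: C_def E_def)
  have D: "\<not> (C < 0 \<and> 0 < E \<or> E < 0 \<and> 0 < C)" "\<not> (C < 1 \<and> 1 < E \<or> E < 1 \<and> 1 < C)"
    using cd[of 0] cd[of 1] assms(3,4) by auto
  have "C < t \<and> t < E \<or> E < t \<and> t < C"
  proof (cases "0 < k")
    case True
    then have "0 < s * k" "0 < (1 - s) * k" using s by auto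
    then show ?thesis by (simp add: C_def E_def)
  next
    case False
    then have "s * k < 0" "(1 - s) * k < 0" using s k0 by (auto simp: mult_pos_neg)
    then show ?thesis unfolding C_def E_def by linarith
  qed
  then have "C = 0 \<and> E = 1 \<or> C = 1 \<and> E = 0"
  proof
    assume "C < t \<and> t < E"
    then have "C \<le> 0" "1 \<le> E" using C t by auto
    then show ?thesis using D by auto
  next
    assume "E < t \<and> t < C"
    then have "E \<le> 0" "1 \<le> C" using C t by auto
    then show ?thesis using D by auto
  qed
  then have "c = a \<and> d = b \<or> c = b \<and> d = a"
    using c d by (auto simp: C_def E_def)
  then show False using assms(7) by auto
qed

text \<open>Together with \<open>coord2\<close>, the oblique coordinates of y in the frame with
  origin p and axes A and B.\<close>

definition coord1 :: "real^2 \<Rightarrow> real^2 \<Rightarrow> real^2 \<Rightarrow> real^2 \<Rightarrow> real" where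
  "coord1 p A B y = cr (y - p) B / cr A B"

definition coord2 :: "real^2 \<Rightarrow> real^2 \<Rightarrow> real^2 \<Rightarrow> real^2 \<Rightarrow> real" where
  "coord2 p A B y = cr A (y - p) / cr A B"

lemma aff_coord1 [intro!]: "aff (coord1 p A B)"
  unfolding coord1_def by (intro aff_divide aff_cr1)

lemma aff_coord2 [intro!]: "aff (coord2 p A B)"
  unfolding coord2_def by (intro aff_divide aff_cr2)

lemma coords:
  assumes "cr A B \<noteq> 0"
  shows "y = p + coord1 p A B y *\<^sub>R A + coord2 p A B y *\<^sub>R B"
  using cr_basis[OF assms, of "y - p"] by (simp add: coord1_def coord2_def algebra_simps)

lemma coord1_eq: "cr A B \<noteq> 0 \<Longrightarrow> coord1 p A B (p + x *\<^sub>R A + y *\<^sub>R B) = x"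
  and coord2_eq: "cr A B \<noteq> 0 \<Longrightarrow> coord2 p A B (p + x *\<^sub>R A + y *\<^sub>R B) = y"
  by (simp_all add: coord1_def coord2_def cr_simps add.assoc)

lemma coord_simps:
  assumes "cr A B \<noteq> 0"
  shows "coord1 p A B p = 0" "coord2 p A B p = 0" "coord1 p A B (p + A) = 1" "coord2 p A B (p + A) = 0"
    "coord1 p A B (p + B) = 0" "coord2 p A B (p + B) = 1"
  using assms by (simp_all add: coord1_def coord2_def cr_simps)

section \<open>Straight-line graphs whose vertices are the points themselves\<close>

definition geo_edges :: "(real^2) set \<Rightarrow> (real^2) set set \<Rightarrow> bool" where
  "geo_edges P S \<longleftrightarrow> (\<forall>e\<in>S. \<exists>a b. e = {a, b} \<and> a \<in> P \<and> b \<in> P \<and> a \<noteq> b \<and> open_segment a b \<inter> P = {})"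

text \<open>There are two arguments because crossings between different classes of edges must be
  excluded as well. An edge in both classes is not taken to cross itself.\<close>

definition noncross :: "(real^2) set set \<Rightarrow> (real^2) set set \<Rightarrow> bool" where
  "noncross S S' \<longleftrightarrow> (\<forall>a b c d. {a, b} \<in> S \<longrightarrow> {c, d} \<in> S' \<longrightarrow> {a, b} \<noteq> {c, d} \<longrightarrow>
     open_segment a b \<inter> open_segment c d = {})"

lemma geo_edgesD:
  assumes "geo_edges P S" "{a, b} \<in> S"
  shows "a \<in> P" "b \<in> P" "a \<noteq> b" "open_segment a b \<inter> P = {}"
proof -
  obtain c d where "{a, b} = {c, d}" "c \<in> P" "d \<in> P" "c \<noteq> d" "open_segment c d \<inter> P = {}"
    using assms unfolding geo_edges_def by blast
  then show "a \<in> P" "b \<in> P" "a \<noteq> b" "open_segment a b \<inter> P = {}"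
    by (auto simp: doubleton_eq_iff open_segment_commute)
qed

lemma noncrossD:
  "noncross S S' \<Longrightarrow> {a, b} \<in> S \<Longrightarrow> {c, d} \<in> S' \<Longrightarrow> x \<in> open_segment a b \<Longrightarrow> x \<in> open_segment c d
    \<Longrightarrow> {a, b} = {c, d}"
  unfolding noncross_def by blast

lemma open_segment_affine:
  assumes "r \<in> open_segment a b"
  obtains t where "0 < t" "t < 1" "r = (1 - t) *\<^sub>R a + t *\<^sub>R b" "a \<noteq> b"
  using assms by (auto simp: in_segment)

lemma collinear_endpoint:
  assumes "r \<in> open_segment p d" "r \<in> open_segment p x"
  obtains k where "0 < k" "d = (1 - k) *\<^sub>R p + k *\<^sub>R (x::real^2)"
proof -
  obtain t where t: "0 < t" "t < 1" "r = (1 - t) *\<^sub>R p + t *\<^sub>R d" using assms(1) by (auto simp: in_segment)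
  obtain s where s: "0 < s" "s < 1" "r = (1 - s) *\<^sub>R p + s *\<^sub>R x" using assms(2) by (auto simp: in_segment)
  have "t *\<^sub>R (d - p) = s *\<^sub>R (x - p)" using t(3) s(3) by (simp add: algebra_simps)
  then have "(1 / t) *\<^sub>R t *\<^sub>R (d - p) = (1 / t) *\<^sub>R s *\<^sub>R (x - p)" by simp
  then have "d - p = (s / t) *\<^sub>R (x - p)" using t by simp
  then have "d = (1 - s / t) *\<^sub>R p + (s / t) *\<^sub>R x" by (simp add: algebra_simps)
  then show thesis using that[of "s / t"] s t by simp
qed

text \<open>
  The point \<open>x\<close> of \<open>P\<close> that is nearest to \<open>p\<close>, as measured by \<open>f\<close>, is hidden from \<open>p\<close> only by
  edges entering the region through its boundary: an edge meeting the segment from \<open>p\<close> to \<open>x\<close>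
  has an end on which \<open>f\<close> is small, and which therefore lies outside.
\<close>

lemma nearest_point_blocked:
  assumes \<Phi>: "finite \<Phi>" "\<forall>\<phi>\<in>\<Phi>. aff \<phi>" and f: "aff f"
    and p: "\<forall>\<phi>\<in>\<Phi>. 0 \<le> \<phi> p" and x: "\<forall>\<phi>\<in>\<Phi>. 0 \<le> \<phi> x" "x \<in> P" "f p < f x"
    and min: "\<forall>y\<in>P. (\<forall>\<phi>\<in>\<Phi>. 0 \<le> \<phi> y) \<longrightarrow> y \<noteq> p \<longrightarrow> f x \<le> f y"
    and edge: "c \<in> P" "d \<in> P" "open_segment c d \<inter> P = {}"
    and r: "r \<in> open_segment c d" "r \<in> open_segment p x" "{c, d} \<noteq> {p, x}"
  obtains e z \<phi> t where "e \<in> {c, d}" "\<phi> \<in> \<Phi>" "0 \<le> t" "t < 1" "z = (1 - t) *\<^sub>R r + t *\<^sub>R e"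
    "z \<in> open_segment c d" "\<forall>\<psi>\<in>\<Phi>. 0 \<le> \<psi> z" "\<phi> z = 0" "\<phi> e < 0" "f z < f x" "f e \<le> f r"
proof -
  obtain e where e: "e \<in> {c, d}" "f e \<le> f r" using aff_open_segment_le[OF f r(1)] .
  obtain s where s: "0 < s" "s < 1" "r = (1 - s) *\<^sub>R p + s *\<^sub>R x"
    using r(2) by (auto simp: in_segment)
  have "f r = (1 - s) * f p + s * f x" unfolding s(3) by (rule affD[OF f])
  also have "\<dots> < (1 - s) * f x + s * f x" using s x(3) by simp
  finally have fr: "f r < f x" by (simp add: algebra_simps)
  have in_D: "0 \<le> \<phi> ((1 - k) *\<^sub>R p + k *\<^sub>R x)" if "\<phi> \<in> \<Phi>" "0 \<le> k" "k \<le> 1" for \<phi> k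
    using \<Phi>(2) p x(1) that by (simp add: affD)
  have e_P: "e \<in> P" using e edge by auto
  have "e \<noteq> p"
  proof
    assume "e = p"
    define d' where "d' = (if e = c then d else c)"
    have d': "d' \<in> P" "{c, d} = {p, d'}" "open_segment p d' \<inter> P = {}" "r \<in> open_segment p d'"
      using e edge r \<open>e = p\<close> by (auto simp: d'_def open_segment_commute)
    have ne: "p \<noteq> d'" using d'(4) by auto
    obtain k where k: "0 < k" "d' = (1 - k) *\<^sub>R p + k *\<^sub>R x"
      using collinear_endpoint[OF d'(4) r(2)] .
    consider "k < 1" | "k = 1" | "1 < k" by linarith
    then show False
    proof cases
      case 1
      have "f d' = (1 - k) * f p + k * f x" unfolding k(2) by (rule affD[OF f])
      also have "\<dots> < (1 - k) * f x + k * f x" using 1 x(3) by simp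
      finally have "f d' < f x" by (simp add: algebra_simps)
      moreover have "f x \<le> f d'" using in_D[of _ k] 1 k d'(1) ne min by auto
      ultimately show False by simp
    next
      case 2 then show False using k d'(2) r(3) by simp
    next
      case 3
      have "x = (1 - 1 / k) *\<^sub>R p + (1 / k) *\<^sub>R d'" unfolding k(2) using 3 by (simp add: algebra_simps)
      then have "x \<in> open_segment p d'" using 3 ne unfolding in_segment
        by (intro conjI exI[of _ "1 / k"]) auto
      then show False using d'(3) x(2) by auto
    qed
  qed
  then have "\<exists>\<phi>\<in>\<Phi>. \<phi> e < 0"
    using min e_P fr e(2) by force
  moreover have "0 \<le> \<phi> r" if "\<phi> \<in> \<Phi>" for \<phi> using in_D[OF that] s by simp
  ultimately obtain \<phi> t where *: "\<phi> \<in> \<Phi>" "0 \<le> t" "t < 1" "\<phi> ((1 - t) *\<^sub>R r + t *\<^sub>R e) = 0" "\<phi> e < 0"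
    "\<And>\<psi>. \<psi> \<in> \<Phi> \<Longrightarrow> 0 \<le> \<psi> ((1 - t) *\<^sub>R r + t *\<^sub>R e)"
    using exit_point[OF \<Phi>(1), of r e] \<Phi>(2) by metis
  define z where "z = (1 - t) *\<^sub>R r + t *\<^sub>R e"
  have "f z = (1 - t) * f r + t * f e" unfolding z_def by (rule affD[OF f])
  also have "\<dots> \<le> (1 - t) * f r + t * f r" using e(2) * by (intro add_left_mono mult_left_mono) auto
  finally have "f z < f x" using fr by (simp add: algebra_simps)
  moreover have "z \<in> open_segment c d" unfolding z_def by (rule open_segment_move) (use r e * in auto)
  ultimately show thesis using that[of e \<phi> t z] * e z_def by auto
qed

text \<open>By compactness the part of K on the segment has a point nearest to m, and all points
  before it on the segment are nearer still.\<close>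

lemma first_hit:
  fixes m x :: "'a::euclidean_space"
  assumes "compact K" "x \<in> K" "m \<notin> K"
  obtains r where "r \<in> K" "r \<in> closed_segment m x" "r \<noteq> m" "open_segment m r \<inter> K = {}"
proof -
  have "compact (K \<inter> closed_segment m x)" "K \<inter> closed_segment m x \<noteq> {}"
    using assms by (auto intro!: compact_Int)
  then obtain r where r: "r \<in> K \<inter> closed_segment m x" "\<And>y. y \<in> K \<inter> closed_segment m x \<Longrightarrow> dist m r \<le> dist m y"
    using distance_attains_inf[of "K \<inter> closed_segment m x" m] by (auto simp: compact_imp_closed)
  have "open_segment m r \<inter> K = {}"
  proof (rule ccontr)
    assume "\<not> ?thesis"
    then obtain y where y: "y \<in> open_segment m r" "y \<in> K" by auto
    then have "y \<in> closed_segment m x"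
      using r(1) by (meson IntD2 ends_in_segment(1) segment_open_subset_closed subset_closed_segment subset_eq)
    then have "dist m r \<le> dist m y" using r(2) y by auto
    moreover have "dist m y < dist m r" using dist_in_open_segment[OF y(1)] by (simp add: dist_commute)
    ultimately show False by simp
  qed
  then show thesis using that[of r] r(1) assms(3) by auto
qed

subsection \<open>Triangles in maximal plane graphs\<close>

lemma mem_open_segment_add:
  assumes "0 < t" "t < 1" "A \<noteq> 0"
  shows "p + t *\<^sub>R A \<in> open_segment p (p + (A::real^2))"
  using assms by (auto simp: in_segment intro!: exI[of _ t] simp: algebra_simps)

lemma aff_coords:
  assumes "aff h"
  shows "h (p + a *\<^sub>R A + b *\<^sub>R B) = h p + a * (h (p + A) - h p) + b * (h (p + B) - h p)"
proof -
  have 1: "h (p + (2 * x) *\<^sub>R C) = h p + 2 * x * (h (p + C) - h p)" for x C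
    using affD[OF assms, of "2 * x" p "p + C"] by (simp add: algebra_simps)
  \<comment> \<open>The point is the midpoint of two points on the axes, each at twice the distance;
    this reduces the claim to \<open>affD\<close> along lines.\<close>
  have "p + a *\<^sub>R A + b *\<^sub>R B = (1 - 1/2) *\<^sub>R (p + (2 * a) *\<^sub>R A) + (1/2) *\<^sub>R (p + (2 * b) *\<^sub>R B)"
    by (simp add: algebra_simps flip: scaleR_add_left)
  then have "h (p + a *\<^sub>R A + b *\<^sub>R B) = (1 - 1/2) * h (p + (2 * a) *\<^sub>R A) + (1/2) * h (p + (2 * b) *\<^sub>R B)"
    by (simp only: affD[OF assms])
  also have "\<dots> = h p + a * (h (p + A) - h p) + b * (h (p + B) - h p)"
    unfolding 1 by (simp add: field_simps)
  finally show ?thesis .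
qed

text \<open>Look from m towards \<open>x0\<close>. If the first obstacle is an edge rather than a
  vertex, turn the line of sight towards an end d of that edge on the positive side: the first
  vertex swept over, d at the latest, is visible.\<close>

lemma visible_point:
  assumes P: "finite P" "geo_edges P T" "noncross T T" "finite T"
    and uv: "{u, v} \<in> T" "m \<in> open_segment u v"
    and h: "aff h" "h u = 0" "h v = 0" and x0: "x0 \<in> P" "0 < h x0"
  shows "\<exists>x\<in>P. 0 < h x \<and> open_segment m x \<inter> P = {} \<and>
           (\<forall>c d. {c, d} \<in> T \<longrightarrow> open_segment c d \<inter> open_segment m x = {})"
proof -
  note E = geo_edgesD[OF P(2)]
  have hm: "h m = 0" using uv(2) h by (elim aff_open_segment[OF h(1)]) auto
  have mP: "m \<notin> P" using uv E(4)[OF uv(1)] by auto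
  \<comment> \<open>The edge uv is left out because m lies on it. It cannot obstruct the view
    anyway, being contained in the line where h vanishes; this is \<open>free\<close>.\<close>
  define K where "K = P \<union> (\<Union>e\<in>T - {{u, v}}. convex hull e)"
  have m_edge: "{c, d} = {u, v}" if "{c, d} \<in> T" "m \<in> open_segment c d" for c d
    using noncrossD[OF P(3) that(1) uv(1) that(2) uv(2)] .
  have cpt: "compact (convex hull e)" if "e \<in> T" for e
  proof -
    have "finite e" using that P(2) unfolding geo_edges_def by auto
    then show ?thesis by (rule finite_imp_compact_convex_hull)
  qed
  have hull: "convex hull {c, d} = insert c (insert d (open_segment c d))" for c d :: "real^2"
    unfolding segment_convex_hull[symmetric] by (auto simp: closed_segment_eq_open)
  have "compact (\<Union>e\<in>T - {{u, v}}. convex hull e)"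
    by (intro compact_UN) (use P(4) cpt in auto)
  then have "compact K" unfolding K_def
    using compact_Un finite_imp_compact[OF P(1)] by blast
  moreover have "x0 \<in> K" using x0 by (simp add: K_def)
  moreover have "m \<notin> K"
  proof
    assume "m \<in> K"
    then obtain e where e: "e \<in> T" "e \<noteq> {u, v}" "m \<in> convex hull e" using mP by (auto simp: K_def)
    then obtain c d where cd: "e = {c, d}" "c \<in> P" "d \<in> P" using P(2) unfolding geo_edges_def by blast
    then have "m \<in> open_segment c d" using e(3) mP unfolding cd hull by auto
    then show False using m_edge e cd by auto
  qed
  ultimately obtain r where r: "r \<in> K" "r \<in> closed_segment m x0" "r \<noteq> m" "open_segment m r \<inter> K = {}"
    by (rule first_hit)
  have mr_P: "open_segment m r \<inter> P = {}" using r(4) by (auto simp: K_def)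
  obtain k where k: "0 \<le> k" "k \<le> 1" "r = (1 - k) *\<^sub>R m + k *\<^sub>R x0" using r(2) by (auto simp: in_segment)
  have "k \<noteq> 0" using k(3) r(3) by auto
  then have hr: "0 < h r" using k x0(2) hm by (simp add: affD[OF h(1)])
  have free: "open_segment c d \<inter> open_segment m y = {} \<or> {c, d} \<noteq> {u, v}" if "0 < h y" for c d y
  proof (rule ccontr)
    assume "\<not> ?thesis"
    then obtain q where q: "q \<in> open_segment c d" "q \<in> open_segment m y" "{c, d} = {u, v}" by auto
    have "h c = 0" "h d = 0" using q(3) h by (auto simp: doubleton_eq_iff)
    then have "h q = 0" using q(1) by (elim aff_open_segment[OF h(1)]) auto
    moreover have "0 < h q" using q(2) hm that by (elim aff_open_segment[OF h(1)]) auto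
    ultimately show False by simp
  qed
  have mr_T: "open_segment c d \<inter> open_segment m r = {}" if "{c, d} \<in> T" for c d
  proof (cases "{c, d} = {u, v}")
    case True then show ?thesis using free[OF hr, of c d] by blast
  next
    case False
    then have "convex hull {c, d} \<subseteq> K" using that unfolding K_def by blast
    then have "open_segment c d \<subseteq> K" unfolding hull by blast
    then show ?thesis using r(4) by auto
  qed
  show ?thesis
  proof (cases "r \<in> P")
    case True then show ?thesis using hr mr_P mr_T by auto
  next
    case False
    then obtain e where e: "e \<in> T" "e \<noteq> {u, v}" "r \<in> convex hull e" using r(1) by (auto simp: K_def)
    then obtain c0 d0 where cd0: "e = {c0, d0}" using P(2) unfolding geo_edges_def by blast
    have r0: "r \<in> open_segment c0 d0" using e(1,3) False E(1,2)[of c0 d0] unfolding cd0 hull by auto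
    \<comment> \<open>As h is positive at r, at least one end of the blocking edge has positive h;
      that end is named d.\<close>
    obtain c d where cd: "e = {c, d}" "r \<in> open_segment c d" "0 < h d"
    proof -
      obtain b where b: "b \<in> {c0, d0}" "- h b \<le> - h r"
        using aff_open_segment_le[OF aff_uminus[OF h(1)] r0] .
      then consider "b = c0" | "b = d0" by auto
      then show thesis
        by cases (use b hr r0 cd0 that[of d0 c0] that[of c0 d0] in
            \<open>auto simp: insert_commute open_segment_commute\<close>)
    qed
    have cdT: "{c, d} \<in> T" using e cd by auto
    define A where "A = r - m"
    define B where "B = d - m"
    \<comment> \<open>Otherwise m, r, c, d are collinear, at positions 0, 1, q, k. No vertex lies
      strictly between m and r, and r lies between c and d, so one end is behind m. Then m is
      interior to cd, contrary to \<open>m_edge\<close>.\<close>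
    have AB: "cr A B \<noteq> 0"
    proof
      assume 0: "cr A B = 0"
      then obtain k where k: "B = k *\<^sub>R A" using cr_zero_parallel r(3) unfolding A_def by force
      obtain t where t: "0 < t" "t < 1" "r = (1 - t) *\<^sub>R c + t *\<^sub>R d" "c \<noteq> d" using cd(2) by (auto simp: in_segment)
      have "(1 - t) *\<^sub>R (c - m) = A - t *\<^sub>R B" unfolding A_def B_def t(3) by (simp add: algebra_simps)
      also have "\<dots> = (1 - t * k) *\<^sub>R A" unfolding k by (simp add: algebra_simps)
      finally have "(1 / (1 - t)) *\<^sub>R (1 - t) *\<^sub>R (c - m) = (1 / (1 - t)) *\<^sub>R (1 - t * k) *\<^sub>R A" by simp
      then have c: "c - m = ((1 - t * k) / (1 - t)) *\<^sub>R A" using t by simp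
      define q where "q = ((1 - t * k) / (1 - t))"
      have mA: "m + A = r" "A \<noteq> 0" using r(3) by (simp_all add: A_def)
      have "d = m + B" "c = m + (c - m)" by (simp_all add: B_def)
      then have dc: "d = m + k *\<^sub>R A" "c = m + q *\<^sub>R A"
        unfolding k c q_def[symmetric] by auto
      have pos: "d \<in> open_segment m r" if "0 < k" "k < 1"
        using mem_open_segment_add[of k A m] that mA dc by simp
      have posc: "c \<in> open_segment m r" if "0 < q" "q < 1"
        using mem_open_segment_add[of q A m] that mA dc by simp
      have nd: "\<not> (0 < k \<and> k < 1)" "\<not> (0 < q \<and> q < 1)"
        using pos posc mr_P E(1,2)[OF cdT] by auto
      have dm: "k \<noteq> 0" "q \<noteq> 0" using k c E(1,2)[OF cdT] mP by (auto simp: B_def q_def)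
      have rr: "(1 - t) * q + t * k = 1" using t by (simp add: q_def)
      have "q \<noteq> 1 \<or> k \<noteq> 1" using False E(1)[OF cdT] c A_def q_def by auto
      have sgn: "q < 0 \<or> k < 0"
      proof (rule ccontr)
        assume "\<not> ?thesis"
        then have "1 \<le> q" "1 \<le> k" using nd dm by auto
        moreover have "(1 - t) * q \<ge> 1 - t" "t * k \<ge> t" using calculation t by auto
        ultimately have "(1 - t) * q = 1 - t" "t * k = t" using rr by linarith+
        then have "q = 1" "k = 1" using t by auto
        then show False using \<open>q \<noteq> 1 \<or> k \<noteq> 1\<close> by auto
      qed
      have qk: "q < 0 \<and> 0 < k \<or> k < 0 \<and> 0 < q"
      proof (rule ccontr)
        assume "\<not> ?thesis"
        then have "q < 0" "k < 0" using sgn dm by linarith+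
        then have "(1 - t) * q < 0" "t * k < 0" using t by (auto simp: mult_pos_neg)
        then show False using rr by linarith
      qed
      define s where "s = - q / (k - q)"
      have s: "0 < s" "s < 1" using qk by (auto simp: s_def divide_simps)
      have "m = (1 - s) *\<^sub>R c + s *\<^sub>R d"
      proof -
        have "(1 - s) *\<^sub>R c + s *\<^sub>R d = m + (1 - s) *\<^sub>R (c - m) + s *\<^sub>R B"
          by (simp add: B_def algebra_simps)
        also have "\<dots> = m + ((1 - s) * q + s * k) *\<^sub>R A"
          unfolding c k q_def[symmetric] by (simp add: algebra_simps)
        also have "(1 - s) * q + s * k = q + s * (k - q)" by (simp add: algebra_simps)
        also have "\<dots> = 0" using qk by (auto simp: s_def)
        finally show ?thesis by simp
      qed
      then have "m \<in> open_segment c d" using s t(4) by (auto simp: in_segment)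
      then show False using m_edge[OF cdT] e(2) cd(1) by auto
    qed
    let ?a = "coord1 m A B" and ?b = "coord2 m A B"
    note co = coords[OF AB, where p = m]
    have val: "?a m = 0" "?b m = 0" "?a r = 1" "?b r = 0" "?a d = 0" "?b d = 1"
      using coord_simps[OF AB, of m] by (simp_all add: A_def B_def)
    have ac: "aff ?a" "aff ?b" by auto
    \<comment> \<open>The vertices in the triangle m r d.\<close>
    define Q where "Q = {y \<in> P. 0 \<le> ?a y \<and> 0 \<le> ?b y \<and> ?a y + ?b y \<le> 1}"
    have dQ: "d \<in> Q" using E(2)[OF cdT] val by (auto simp: Q_def)
    have fQ: "finite Q" using P(1) by (auto simp: Q_def)
    have on_mr: "m + t *\<^sub>R A \<in> open_segment m r" if "0 < t" "t < 1" for t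
      using mem_open_segment_add[OF that, of A m] r(3) by (auto simp: A_def)
    have bpos: "0 < ?b y" if "y \<in> Q" for y
    proof (rule ccontr)
      assume "\<not> 0 < ?b y"
      then have b0: "?b y = 0" using that by (auto simp: Q_def)
      then have y: "y = m + ?a y *\<^sub>R A" using co[of y] by simp
      have "?a y \<noteq> 0" using y mP that by (auto simp: Q_def)
      moreover have "?a y \<noteq> 1"
      proof
        assume "?a y = 1"
        then have "y = r" using y by (simp add: A_def)
        then show False using that False by (simp add: Q_def)
      qed
      ultimately have "0 < ?a y" "?a y < 1" using that b0 by (auto simp: Q_def)
      then have "m + ?a y *\<^sub>R A \<in> open_segment m r" by (rule on_mr)
      then show False using y mr_P that by (auto simp: Q_def)
    qed
    \<comment> \<open>The smaller R, the closer the direction from m is to that of r. Among the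
      vertices of Q in the extreme direction, y is the one nearest to m.\<close>
    define R where "R y = - ?a y / ?b y" for y
    obtain y0 where y0: "y0 \<in> Q" "\<And>y. y \<in> Q \<Longrightarrow> R y0 \<le> R y"
      using fQ dQ by (metis arg_min_if_finite(1) arg_min_least empty_iff)
    define Q' where "Q' = {y \<in> Q. R y = R y0}"
    have "finite Q'" "Q' \<noteq> {}" using fQ y0 by (auto simp: Q'_def)
    then obtain y where y: "y \<in> Q'" "\<And>w. w \<in> Q' \<Longrightarrow> ?b y \<le> ?b w"
      by (metis arg_min_if_finite(1) arg_min_least)
    have yQ: "y \<in> Q" and Ry: "\<And>w. w \<in> Q \<Longrightarrow> R y \<le> R w" using y(1) y0 by (auto simp: Q'_def)
    have yP: "y \<in> P" using yQ by (simp add: Q_def)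
    have by0: "0 < ?b y" by (rule bpos[OF yQ])
    have ay0: "0 \<le> ?a y" "?a y + ?b y \<le> 1" using yQ by (auto simp: Q_def)
    have hy_co: "h w = ?a w * h r + ?b w * h d" for w
      using aff_coords[OF h(1), of m "?a w" A "?b w" B] co[of w] hm by (simp add: A_def B_def)
    have hy: "0 < h y" unfolding hy_co[of y] using ay0 by0 hr cd(3)
      by (simp add: add_nonneg_pos)
    have scale: "?a ((1 - t) *\<^sub>R m + t *\<^sub>R w) = t * ?a w" "?b ((1 - t) *\<^sub>R m + t *\<^sub>R w) = t * ?b w" for t w
      using val by (simp_all add: affD[OF ac(1)] affD[OF ac(2)])
    have my_P: "open_segment m y \<inter> P = {}"
    proof (rule ccontr)
      assume "\<not> ?thesis"
      then obtain w where w: "w \<in> open_segment m y" "w \<in> P" by auto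
      then obtain t where t: "0 < t" "t < 1" "w = (1 - t) *\<^sub>R m + t *\<^sub>R y" by (auto simp: in_segment)
      have c: "?a w = t * ?a y" "?b w = t * ?b y" unfolding t(3) scale by auto
      have "?a w + ?b w = t * (?a y + ?b y)" using c by (simp add: algebra_simps)
      also have "\<dots> \<le> 1" using t ay0 by0 by (intro mult_le_one) auto
      finally have "w \<in> Q" using c t ay0 by0 w by (auto simp: Q_def)
      moreover have "R w = R y" using c t by (simp add: R_def)
      ultimately have "w \<in> Q'" using y(1) by (auto simp: Q'_def)
      then have "?b y \<le> ?b w" by (rule y(2))
      then show False using c t by0 by simp
    qed
    have "open_segment c' d' \<inter> open_segment m y = {}" if T': "{c', d'} \<in> T" for c' d'
    proof (rule ccontr)
      assume ne: "\<not> ?thesis"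
      then obtain q where q: "q \<in> open_segment c' d'" "q \<in> open_segment m y" by auto
      have ne_uv: "{c', d'} \<noteq> {u, v}" using free[OF hy, of c' d'] ne by blast
      have m_cd: "m \<notin> open_segment c' d'" using m_edge[OF T'] ne_uv by auto
      have PP: "c' \<in> P" "d' \<in> P" "open_segment c' d' \<inter> P = {}" using E[OF T'] by auto
      have cr0: "cr (y - m) (d' - c') \<noteq> 0"
        by (rule proper_crossing[OF q(2,1)]) (use m_cd PP yP my_P mP in \<open>auto simp: doubleton_eq_iff\<close>)
      \<comment> \<open>Zero on the line through m and y, positive on the side of r.\<close>
      define \<kappa> where "\<kappa> w = ?b y * ?a w - ?a y * ?b w" for w
      have a\<kappa>: "aff \<kappa>" unfolding \<kappa>_def by (intro aff_diff aff_mult ac)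
      obtain t where t: "0 < t" "t < 1" "q = (1 - t) *\<^sub>R m + t *\<^sub>R y" using q(2) by (auto simp: in_segment)
      have qv: "?a q = t * ?a y" "?b q = t * ?b y" unfolding t(3) scale by auto
      have \<kappa>q: "\<kappa> q = 0" using qv by (simp add: \<kappa>_def)
      have "\<kappa> d' - \<kappa> c' = cr (y - m) (d' - c') * (- 1 / cr A B)"
      proof -
        have dc: "d' - c' = (?a d' - ?a c') *\<^sub>R A + (?b d' - ?b c') *\<^sub>R B"
          by (subst (1) co[of d'], subst (1) co[of c']) (simp add: algebra_simps)
        have ym: "y - m = ?a y *\<^sub>R A + ?b y *\<^sub>R B" by (subst (1) co[of y]) simp
        show ?thesis unfolding dc ym \<kappa>_def using AB cr_commute[of A B]
          by (simp add: cr_simps field_simps)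
      qed
      then have "\<kappa> d' \<noteq> \<kappa> c'" using cr0 AB by auto
      then have "- \<kappa> c' \<noteq> 0 \<or> - \<kappa> d' \<noteq> 0" by auto
      then obtain e' where e': "e' \<in> {c', d'}" "- \<kappa> e' < 0"
        using aff_open_segment_zero_neg[OF aff_uminus[OF a\<kappa>] q(1)] \<kappa>q by auto
      \<comment> \<open>The part of the triangle m r d on the side of r of the line my. An end
        \<open>e'\<close> of a crossing edge in this part would have a direction closer to r than y
        has, so the edge must leave the part; each possible exit is then excluded.\<close>
      define \<Phi> where "\<Phi> = {\<kappa>, ?b, \<lambda>w. 1 - (?a w + ?b w)}"
      have \<Phi>: "finite \<Phi>" "\<And>\<phi>. \<phi> \<in> \<Phi> \<Longrightarrow> aff \<phi>"
        using a\<kappa> ac unfolding \<Phi>_def by (auto intro!: aff_diff aff_add aff_const)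
      have qab: "?a q + ?b q < 1"
      proof -
        have "?a q + ?b q = t * (?a y + ?b y)" using qv by (simp add: algebra_simps)
        also have "\<dots> \<le> t * 1" using t ay0 by (intro mult_left_mono) auto
        finally show ?thesis using t by simp
      qed
      have q\<Phi>: "0 \<le> \<phi> q" if "\<phi> \<in> \<Phi>" for \<phi>
        using that \<kappa>q qab qv t by0 by (auto simp: \<Phi>_def)
      have "\<exists>\<phi>\<in>\<Phi>. \<phi> e' < 0"
      proof (rule ccontr)
        assume "\<not> ?thesis"
        then have "0 \<le> \<kappa> e'" "0 \<le> ?b e'" "?a e' + ?b e' \<le> 1" by (auto simp: \<Phi>_def)
        moreover have "0 \<le> ?a e'"
        proof -
          have "0 \<le> ?a y * ?b e'" using ay0 calculation by simp
          then have "0 \<le> ?b y * ?a e'" using calculation(1) by (simp add: \<kappa>_def)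
          then show ?thesis using by0 by (simp add: zero_le_mult_iff)
        qed
        ultimately have eQ: "e' \<in> Q" using e'(1) PP by (auto simp: Q_def)
        have "R y \<le> R e'" by (rule Ry[OF eQ])
        then have "?a e' / ?b e' \<le> ?a y / ?b y" by (simp add: R_def)
        then have "?a e' * ?b y \<le> ?a y * ?b e'" using by0 bpos[OF eQ] by (simp add: divide_simps)
        then show False using e'(2) by (simp add: \<kappa>_def mult.commute)
      qed
      then obtain \<phi> s where s: "\<phi> \<in> \<Phi>" "0 \<le> s" "s < 1" "\<phi> ((1 - s) *\<^sub>R q + s *\<^sub>R e') = 0" "\<phi> e' < 0"
        "\<And>\<psi>. \<psi> \<in> \<Phi> \<Longrightarrow> 0 \<le> \<psi> ((1 - s) *\<^sub>R q + s *\<^sub>R e')"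
        using exit_point[OF \<Phi>, of q e'] q\<Phi> by metis
      define z where "z = (1 - s) *\<^sub>R q + s *\<^sub>R e'"
      have z: "z \<in> open_segment c' d'" unfolding z_def by (rule open_segment_move) (use q e' s in auto)
      have zD: "0 \<le> \<kappa> z" "0 \<le> ?b z" "?a z + ?b z \<le> 1" "\<phi> z = 0"
        using s(4) s(6)[of \<kappa>] s(6)[of ?b] s(6)[of "\<lambda>w. 1 - (?a w + ?b w)"]
        by (simp_all add: \<Phi>_def z_def)
      have az: "0 \<le> ?a z"
      proof -
        have "0 \<le> ?a y * ?b z" using ay0 zD by simp
        then have "0 \<le> ?b y * ?a z" using zD(1) by (simp add: \<kappa>_def)
        then show ?thesis using by0 by (simp add: zero_le_mult_iff)
      qed
      \<comment> \<open>If z were on cd, the two edges would be the same; but q lies strictly on the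
        near side of the line through r and d.\<close>
      have not_cd: "z \<notin> open_segment c d"
      proof
        assume "z \<in> open_segment c d"
        then have "{c', d'} = {c, d}" using noncrossD[OF P(3) T' cdT z] by simp
        then have qcd: "q \<in> open_segment c d" using q(1) by (auto simp: doubleton_eq_iff open_segment_commute)
        define \<psi> where "\<psi> w = ?a w + ?b w - 1" for w
        have a\<psi>: "aff \<psi>" unfolding \<psi>_def by (intro aff_diff aff_add ac aff_const)
        have \<psi>: "\<psi> r = 0" "\<psi> d = 0" using val by (auto simp: \<psi>_def)
        have "\<psi> c = 0" using aff_open_segment[OF a\<psi> cd(2)] \<psi> by (metis add.right_neutral diff_gt_0_iff_gt less_irrefl mult_eq_0_iff mult_zero_right)
        then have "\<psi> q = 0" using aff_open_segment[OF a\<psi> qcd] \<psi> by (metis add.right_neutral mult_zero_right)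
        then show False using qab by (simp add: \<psi>_def)
      qed
      consider "\<phi> = \<kappa>" | "\<phi> = ?b" | "\<phi> = (\<lambda>w. 1 - (?a w + ?b w))" using s(1) by (auto simp: \<Phi>_def)
      then show False
      proof cases
        case 1 then show ?thesis using s(5) e'(2) by simp
      next
        case 2
        then have zz: "z = m + ?a z *\<^sub>R A" using zD(4) co[of z] by simp
        have "?a z \<le> 1" using zD 2 by simp
        moreover have "?a z \<noteq> 0" using zz m_cd z by auto
        moreover have "?a z \<noteq> 1" using zz z not_cd cd(2) by (auto simp: A_def)
        ultimately have "z \<in> open_segment m r" using zz on_mr[of "?a z"] az by auto
        then show False using mr_T[OF T'] z by auto
      next
        case 3
        then have ab1: "?a z = 1 - ?b z" using zD(4) by simp
        have zz: "z = (1 - ?b z) *\<^sub>R r + ?b z *\<^sub>R d"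
          using co[of z] unfolding ab1 by (simp add: A_def B_def algebra_simps)
        have "?b z \<noteq> 1" using zz z PP(3) E(2)[OF cdT] by auto
        then have "z \<in> open_segment c d" using zz zD az ab1
          by (metis open_segment_move[OF cd(2), of d "?b z"] diff_ge_0_iff_ge insertI1 insertI2 order_le_less)
        then show False using not_cd by simp
      qed
    qed
    then show ?thesis using yP hy my_P by auto
  qed
qed

text \<open>A triangulation described without faces: two points that could still be joined are
  already joined.\<close>

definition max_plane :: "(real^2) set \<Rightarrow> (real^2) set set \<Rightarrow> bool" where
  "max_plane P T \<longleftrightarrow> geo_edges P T \<and> noncross T T \<and>
     (\<forall>a\<in>P. \<forall>b\<in>P. a \<noteq> b \<longrightarrow> open_segment a b \<inter> P = {} \<longrightarrow>
        (\<forall>c d. {c, d} \<in> T \<longrightarrow> {c, d} \<noteq> {a, b} \<longrightarrow> open_segment c d \<inter> open_segment a b = {}) \<longrightarrow> {a, b} \<in> T)"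

lemma geo_edges_subset: "geo_edges P S \<Longrightarrow> S \<subseteq> Pow P"
  unfolding geo_edges_def by auto

lemma geo_edges_finite: "finite P \<Longrightarrow> geo_edges P S \<Longrightarrow> finite S"
  using geo_edges_subset finite_subset by blast

lemma noncross_insert:
  assumes "noncross S S'" "\<And>c d. {c, d} \<in> S' \<Longrightarrow> {c, d} \<noteq> {a, b} \<Longrightarrow> open_segment c d \<inter> open_segment a b = {}"
  shows "noncross (insert {a, b} S) S'"
  unfolding noncross_def
proof (intro allI impI)
  fix a' b' c d assume *: "{a', b'} \<in> insert {a, b} S" "{c, d} \<in> S'" "{a', b'} \<noteq> {c, d}"
  show "open_segment a' b' \<inter> open_segment c d = {}"
  proof (cases "{a', b'} \<in> S")
    case True then show ?thesis using assms(1) * unfolding noncross_def by blast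
  next
    case False
    then have "{a', b'} = {a, b}" using * by simp
    then have "open_segment a' b' = open_segment a b" by (auto simp: doubleton_eq_iff open_segment_commute)
    then show ?thesis using assms(2)[OF *(2)] *(3) \<open>{a', b'} = {a, b}\<close> by (metis Int_commute)
  qed
qed

lemma noncross_sym: "noncross S S' \<Longrightarrow> noncross S' S"
  unfolding noncross_def by (metis Int_commute)

text \<open>Only finitely many edge sets exist on P, so a maximal one above S can be taken. Edges of
  \<open>Ob\<close> are obstacles for T, though one that crosses nothing may itself belong to T.
  Without obstacles the result is a maximal plane graph.\<close>

lemma maximal_noncross:
  assumes "finite P" "geo_edges P S" "noncross S S" "noncross S Ob"
  obtains T where "S \<subseteq> T" "geo_edges P T" "noncross T T" "noncross T Ob"
    "\<forall>a\<in>P. \<forall>b\<in>P. a \<noteq> b \<longrightarrow> open_segment a b \<inter> P = {} \<longrightarrow>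
       (\<forall>c d. {c, d} \<in> Ob \<union> T \<longrightarrow> {c, d} \<noteq> {a, b} \<longrightarrow> open_segment c d \<inter> open_segment a b = {}) \<longrightarrow> {a, b} \<in> T"
proof -
  define \<F> where "\<F> = {T. geo_edges P T \<and> noncross T T \<and> noncross T Ob}"
  have "\<F> \<subseteq> Pow (Pow P)" using geo_edges_subset by (auto simp: \<F>_def)
  then have "finite \<F>" using assms(1) by (meson finite_Pow_iff finite_subset)
  moreover have "S \<in> \<F>" using assms by (simp add: \<F>_def)
  ultimately obtain T where T: "T \<in> \<F>" "S \<subseteq> T" "\<And>T'. T' \<in> \<F> \<Longrightarrow> T \<subseteq> T' \<Longrightarrow> T = T'"
    using finite_has_maximal2 by metis
  have "{a, b} \<in> T" if ab: "a \<in> P" "b \<in> P" "a \<noteq> b" "open_segment a b \<inter> P = {}"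
    "\<forall>c d. {c, d} \<in> Ob \<union> T \<longrightarrow> {c, d} \<noteq> {a, b} \<longrightarrow> open_segment c d \<inter> open_segment a b = {}" for a b
  proof -
    have "geo_edges P (insert {a, b} T)" using T(1) ab unfolding \<F>_def geo_edges_def by blast
    moreover have "noncross (insert {a, b} T) (insert {a, b} T)"
    proof (rule noncross_insert)
      have "noncross (insert {a, b} T) T" using T(1) ab by (intro noncross_insert) (auto simp: \<F>_def)
      then show "noncross T (insert {a, b} T)" by (rule noncross_sym)
    qed (use ab in auto)
    moreover have "noncross (insert {a, b} T) Ob" using T(1) ab by (intro noncross_insert) (auto simp: \<F>_def)
    ultimately have "T = insert {a, b} T" by (intro T(3)) (auto simp: \<F>_def)
    then show ?thesis by blast
  qed
  then show thesis using that[OF T(2)] T(1) unfolding \<F>_def by blast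
qed

lemma max_plane_extend:
  assumes "finite P" "geo_edges P S" "noncross S S"
  obtains T where "S \<subseteq> T" "max_plane P T"
proof -
  have "noncross S {}" by (simp add: noncross_def)
  then show thesis using maximal_noncross[OF assms, of "{}"] that unfolding max_plane_def by simp metis
qed

definition visible :: "(real^2) set \<Rightarrow> (real^2) set set \<Rightarrow> real^2 \<Rightarrow> real^2 \<Rightarrow> bool" where
  "visible P T m x \<longleftrightarrow> open_segment m x \<inter> P = {} \<and>
     (\<forall>c d. {c, d} \<in> T \<longrightarrow> open_segment c d \<inter> open_segment m x = {})"

text \<open>A further vertex in the triangle m u w, chosen closest to m in the sense of f, would be
  visible from m and have smaller h than w. An edge across uw would likewise have to leave the
  triangle through the side on uv or through the unobstructed segment mw. Applied at u and at v,
  this gives both halves of a triangle over uv.\<close>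

lemma lowest_visible_point:
  assumes P: "finite P" "max_plane P T"
    and uv: "{u, v} \<in> T" "m \<in> open_segment u v"
    and h: "aff h" "h u = 0" "h v = 0"
    and w: "w \<in> P" "0 < h w" "visible P T m w"
    and low: "\<forall>x\<in>P. 0 < h x \<longrightarrow> visible P T m x \<longrightarrow> h w \<le> h x"
  shows "cr (u - m) (w - m) \<noteq> 0" (is ?t1)
    and "\<And>x. x \<in> P \<Longrightarrow> 0 \<le> coord1 m (u - m) (w - m) x \<Longrightarrow> 0 \<le> coord2 m (u - m) (w - m) x \<Longrightarrow>
            coord1 m (u - m) (w - m) x + coord2 m (u - m) (w - m) x \<le> 1 \<Longrightarrow> x = u \<or> x = w" (is "PROP ?t2")
    and "{u, w} \<in> T" (is ?t3)
proof -
  have P2: "geo_edges P T" "noncross T T" using P by (auto simp: max_plane_def)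
  note E = geo_edgesD[OF P2(1)]
  define A where "A = u - m"
  define B where "B = w - m"
  have hm: "h m = 0" using uv(2) h by (elim aff_open_segment[OF h(1)]) auto
  have mP: "m \<notin> P" using uv E(4)[OF uv(1)] by auto
  have A0: "A \<noteq> 0" using mP E(1)[OF uv(1)] by (auto simp: A_def)
  have hA: "h (m + k *\<^sub>R A) = 0" for k
    using aff_coords[OF h(1), of m k A 0 0] h hm by (simp add: A_def)
  have AB: "cr A B \<noteq> 0"
  proof
    assume "cr A B = 0"
    then obtain k where "B = k *\<^sub>R A" using cr_zero_parallel A0 by blast
    then have "w = m + k *\<^sub>R A" by (simp add: B_def algebra_simps)
    then show False using hA w(2) by auto
  qed
  then show ?t1 by (simp add: A_def B_def)
  let ?a = "coord1 m A B" and ?b = "coord2 m A B"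
  note co = coords[OF AB, where p = m]
  have val: "?a m = 0" "?b m = 0" "?a u = 1" "?b u = 0" "?a w = 0" "?b w = 1"
    using coord_simps[OF AB, of m] by (simp_all add: A_def B_def)
  have ac: "aff ?a" "aff ?b" by auto
  \<comment> \<open>The level lines of f are parallel to uw, with f = 0 at m and f = 1 on
    uw.\<close>
  define f where "f x = ?a x + ?b x" for x
  have af: "aff f" unfolding f_def by (intro aff_add ac)
  have fv: "f m = 0" "f u = 1" "f w = 1" using val by (auto simp: f_def)
  have hco: "h x = ?b x * h w" for x
    using aff_coords[OF h(1), of m "?a x" A "?b x" B] co[of x] hm h by (simp add: A_def B_def)
  have hedge: "h q = 0" if "q \<in> open_segment c d" "{c, d} = {u, v}" for c d q
  proof -
    have "h c = 0" "h d = 0" using that h by (auto simp: doubleton_eq_iff)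
    then show ?thesis by - (rule aff_open_segment[OF h(1) that(1)], simp)
  qed
  have sub: "m + k *\<^sub>R A \<in> open_segment u v" if "0 \<le> k" "k < 1" for k
    using open_segment_move[OF uv(2), of u k] that by (simp add: A_def algebra_simps)
  \<comment> \<open>The two sides issuing from m are closed to all edges other than uv: one is part
    of uv, the other is a line of sight.\<close>
  have noedge: False if "{c, d} \<in> T" "z \<in> open_segment c d" "{c, d} \<noteq> {u, v}" "0 \<le> ?a z" "0 \<le> ?b z"
    "f z < 1" "?a z = 0 \<or> ?b z = 0" for c d z
  proof -
    have z: "z \<notin> open_segment u v" using noncrossD[OF P2(2) that(1) uv(1) that(2)] that(3) by auto
    from that(7) show False
    proof
      assume "?b z = 0"
      then have "z = m + ?a z *\<^sub>R A" "?a z < 1" using co[of z] that(6) by (auto simp: f_def)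
      then show False using sub[of "?a z"] z that by auto
    next
      assume a: "?a z = 0"
      then have zz: "z = m + ?b z *\<^sub>R B" "?b z < 1" using co[of z] that(6) by (auto simp: f_def)
      have "?b z \<noteq> 0" using zz z uv(2) by auto
      then have "m + ?b z *\<^sub>R B \<in> open_segment m (m + B)"
        using zz that(5) mP w(1) by (intro mem_open_segment_add) (auto simp: B_def)
      then have "z \<in> open_segment m w" using zz by (simp add: B_def)
      then show False using w(3) that unfolding visible_def by blast
    qed
  qed
  have empty: "x = u \<or> x = w" if "x \<in> P" "0 \<le> ?a x" "0 \<le> ?b x" "f x \<le> 1" for x
  proof (rule ccontr)
    assume no: "\<not> ?thesis"
    define Q where "Q = {x \<in> P. 0 \<le> ?a x \<and> 0 \<le> ?b x \<and> f x \<le> 1 \<and> x \<noteq> u \<and> x \<noteq> w}"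
    have "finite Q" "Q \<noteq> {}" using that no P(1) by (auto simp: Q_def)
    then obtain x where x: "x \<in> Q" "\<And>y. y \<in> Q \<Longrightarrow> f x \<le> f y"
      by (metis arg_min_if_finite(1) arg_min_least)
    have xP: "x \<in> P" "0 \<le> ?a x" "0 \<le> ?b x" "f x \<le> 1" "x \<noteq> u" "x \<noteq> w" using x by (auto simp: Q_def)
    have bx: "0 < ?b x"
    proof (rule ccontr)
      assume "\<not> 0 < ?b x"
      then have "?b x = 0" using xP by simp
      then have "x = m + ?a x *\<^sub>R A" "?a x \<le> 1" using co[of x] xP by (auto simp: f_def)
      moreover have "?a x \<noteq> 1" using calculation xP by (auto simp: A_def)
      ultimately have "x \<in> open_segment u v" using sub[of "?a x"] xP by auto
      then show False using E(4)[OF uv(1)] xP by auto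
    qed
    have "?b x < 1"
    proof (rule ccontr)
      assume "\<not> ?b x < 1"
      then have "?b x = 1" "?a x = 0" using xP by (auto simp: f_def)
      then have "x = w" using co[of x] by (simp add: B_def)
      then show False using xP by simp
    qed
    then have hx: "0 < h x" "h x < h w" using hco[of x] bx w(2) by auto
    have fx: "0 < f x" using bx xP by (simp add: f_def)
    define \<Phi> where "\<Phi> = {?a, ?b}"
    have \<Phi>: "finite \<Phi>" "\<And>\<phi>. \<phi> \<in> \<Phi> \<Longrightarrow> aff \<phi>" using ac by (auto simp: \<Phi>_def)
    have min: "f x \<le> f y" if "y \<in> P" "0 \<le> ?a y" "0 \<le> ?b y" for y
    proof (cases "y \<in> Q")
      case True then show ?thesis by (rule x(2))
    next
      case False
      then have "1 \<le> f y" using that fv by (force simp: Q_def)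
      then show ?thesis using xP by simp
    qed
    have seg: "0 < t" "t < 1" "f y = t * f x" "?a y = t * ?a x" "?b y = t * ?b x"
      if "y = (1 - t) *\<^sub>R m + t *\<^sub>R x" "0 < t" "t < 1" for y t
      using that val fv by (auto simp: affD[OF ac(1)] affD[OF ac(2)] affD[OF af])
    have "visible P T m x"
      unfolding visible_def
    proof (intro conjI allI impI)
      show "open_segment m x \<inter> P = {}"
      proof (rule ccontr)
        assume "\<not> ?thesis"
        then obtain y where y: "y \<in> open_segment m x" "y \<in> P" by auto
        then obtain t where t: "0 < t" "t < 1" "y = (1 - t) *\<^sub>R m + t *\<^sub>R x" by (auto simp: in_segment)
        note s = seg[OF t(3,1,2)]
        have "f x \<le> f y" by (rule min) (use y s xP in auto)
        then show False using s fx by simp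
      qed
    next
      fix c d assume cd: "{c, d} \<in> T"
      show "open_segment c d \<inter> open_segment m x = {}"
      proof (rule ccontr)
        assume "\<not> ?thesis"
        then obtain r where r: "r \<in> open_segment c d" "r \<in> open_segment m x" by auto
        then obtain t where t: "0 < t" "t < 1" "r = (1 - t) *\<^sub>R m + t *\<^sub>R x" by (auto simp: in_segment)
        have "0 < h r" using hco[of r] seg[OF t(3,1,2)] bx w(2) by simp
        then have ne: "{c, d} \<noteq> {u, v}" using hedge[OF r(1)] by force
        have ne2: "{c, d} \<noteq> {m, x}" using mP E(1,2)[OF cd] by (auto simp: doubleton_eq_iff)
        have F: "\<forall>\<phi>\<in>\<Phi>. aff \<phi>" "\<forall>\<phi>\<in>\<Phi>. 0 \<le> \<phi> m" "\<forall>\<phi>\<in>\<Phi>. 0 \<le> \<phi> x" "f m < f x"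
          "\<forall>y\<in>P. (\<forall>\<phi>\<in>\<Phi>. 0 \<le> \<phi> y) \<longrightarrow> y \<noteq> m \<longrightarrow> f x \<le> f y"
          using ac val xP fx fv min by (auto simp: \<Phi>_def)
        obtain z \<phi> where z: "\<phi> \<in> \<Phi>" "z \<in> open_segment c d" "\<forall>\<psi>\<in>\<Phi>. 0 \<le> \<psi> z"
          "\<phi> z = 0" "f z < f x"
          by (rule nearest_point_blocked[OF \<Phi>(1) F(1) af F(2,3) xP(1) F(4,5) E(1,2,4)[OF cd] r ne2]) blast
        show False
          by (rule noedge[OF cd z(2) ne]) (use z xP in \<open>auto simp: \<Phi>_def\<close>)
      qed
    qed
    then have "h w \<le> h x" using hx xP low by auto
    then show False using hx by simp
  qed
  then show "PROP ?t2" by (simp add: A_def B_def f_def)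
  have uw: "u \<noteq> w" using w(2) h by auto
  have seg: "0 < ?a y" "0 < ?b y" "f y = 1" if y: "y \<in> open_segment u w" for y
  proof -
    obtain t where "0 < t" "t < 1" "y = (1 - t) *\<^sub>R u + t *\<^sub>R w" using open_segment_affine[OF y] .
    then show "0 < ?a y" "0 < ?b y" "f y = 1"
      using val fv by (auto simp: affD[OF ac(1)] affD[OF ac(2)] affD[OF af])
  qed
  show ?t3
  proof -
    have uw_P: "open_segment u w \<inter> P = {}"
    proof (rule ccontr)
      assume "\<not> ?thesis"
      then obtain y where y: "y \<in> open_segment u w" "y \<in> P" by auto
      then have "y = u \<or> y = w" using seg[OF y(1)] by (intro empty) auto
      then show False using y by (auto simp: open_segment_def)
    qed
    moreover have "open_segment c d \<inter> open_segment u w = {}" if cd: "{c, d} \<in> T" "{c, d} \<noteq> {u, w}" for c d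
    proof (rule ccontr)
      assume "\<not> ?thesis"
      then obtain r where r: "r \<in> open_segment c d" "r \<in> open_segment u w" by auto
      have "0 < h r" using hco[of r] seg[OF r(2)] w(2) by simp
      then have ne: "{c, d} \<noteq> {u, v}" using hedge[OF r(1)] by force
      have PP: "c \<in> P" "d \<in> P" "open_segment c d \<inter> P = {}" using E[OF cd(1)] by auto
      have cr0: "cr (w - u) (d - c) \<noteq> 0"
        by (rule proper_crossing[OF r(2,1)]) (use PP w(1) E(1)[OF uv(1)] uw_P cd in auto)
      have "f c - 1 \<noteq> 0 \<or> f d - 1 \<noteq> 0"
      proof (rule ccontr)
        assume "\<not> ?thesis"
        then have 1: "?a c = 1 - ?b c" "?a d = 1 - ?b d" by (auto simp: f_def)
        have "d - c = (?b d - ?b c) *\<^sub>R (B - A)"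
          by (subst (1) co[of d], subst (1) co[of c]) (simp add: 1 algebra_simps)
        moreover have "w - u = B - A" by (simp add: A_def B_def)
        ultimately show False using cr0 by (simp add: cr_simps)
      qed
      then obtain e where e: "e \<in> {c, d}" "f e - 1 < 0"
        using aff_open_segment_zero_neg[OF aff_diff[OF af aff_const] r(1), of 1] seg[OF r(2)] by auto
      define \<Phi> where "\<Phi> = {?a, ?b}"
      have \<Phi>: "finite \<Phi>" "\<And>\<phi>. \<phi> \<in> \<Phi> \<Longrightarrow> aff \<phi>" using ac by (auto simp: \<Phi>_def)
      have "\<exists>\<phi>\<in>\<Phi>. \<phi> e < 0"
      proof (rule ccontr)
        assume "\<not> ?thesis"
        then have "e = u \<or> e = w" using e PP by (intro empty) (auto simp: \<Phi>_def)
        then show False using fv e by auto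
      qed
      moreover have "0 \<le> \<phi> r" if "\<phi> \<in> \<Phi>" for \<phi> using that seg[OF r(2)] by (auto simp: \<Phi>_def)
      ultimately obtain \<phi> t where z: "\<phi> \<in> \<Phi>" "0 \<le> t" "t < 1" "\<phi> ((1 - t) *\<^sub>R r + t *\<^sub>R e) = 0" "\<phi> e < 0"
        "\<And>\<psi>. \<psi> \<in> \<Phi> \<Longrightarrow> 0 \<le> \<psi> ((1 - t) *\<^sub>R r + t *\<^sub>R e)"
        using exit_point[OF \<Phi>, of r e] by metis
      define z where "z = (1 - t) *\<^sub>R r + t *\<^sub>R e"
      have zo: "z \<in> open_segment c d" unfolding z_def by (rule open_segment_move) (use r e z in auto)
      have "t \<noteq> 0" using z(1,4) seg[OF r(2)] by (auto simp: \<Phi>_def)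
      then have "t * f e < t * 1" using z e by simp
      then have "f z < 1" unfolding z_def affD[OF af] seg(3)[OF r(2)] by simp
      then show False
        by (intro noedge[OF cd(1) zo ne]) (use z(1,4) z(6)[of ?a] z(6)[of ?b] in \<open>auto simp: \<Phi>_def z_def\<close>)
    qed
    ultimately show ?thesis
      using P(2) w(1) E(1)[OF uv(1)] uw unfolding max_plane_def by blast
  qed
qed

text \<open>Any interior point m of uv would do; take the midpoint, and w visible from m and nearest
  to the line uv. The segment mw cuts the triangle u v w into two halves, which are empty by
  \<open>lowest_visible_point\<close> for uv and for vu.\<close>

lemma side_triangle:
  assumes P: "finite P" "max_plane P T" and uv: "{u, v} \<in> T" and x0: "x0 \<in> P" "0 < cr (v - u) (x0 - u)"
  obtains w where "w \<in> P" "0 < cr (v - u) (w - u)" "{u, w} \<in> T" "{v, w} \<in> T"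
    "convex hull {u, v, w} \<inter> P = {u, v, w}"
proof -
  have P2: "geo_edges P T" "noncross T T" using P by (auto simp: max_plane_def)
  note E = geo_edgesD[OF P2(1)]
  define h where "h x = cr (v - u) (x - u)" for x
  have h: "aff h" "h u = 0" "h v = 0" unfolding h_def by (rule aff_cr2) (simp_all add: cr_simps)
  have uvne: "u \<noteq> v" using E(3)[OF uv] .
  define m where "m = (1 - 1/2) *\<^sub>R u + (1/2) *\<^sub>R v"
  have m: "m \<in> open_segment u v" unfolding m_def in_segment using uvne by (intro conjI exI[of _ "1/2"]) auto
  define W where "W = {x \<in> P. 0 < h x \<and> visible P T m x}"
  have "finite T" using geo_edges_finite[OF P(1) P2(1)] .
  then have "W \<noteq> {}"
    using visible_point[OF P(1) P2 _ uv m h x0(1)] x0(2) unfolding W_def visible_def h_def by blast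
  moreover have "finite W" using P by (auto simp: W_def)
  ultimately obtain w where w: "w \<in> W" "\<And>x. x \<in> W \<Longrightarrow> h w \<le> h x"
    by (metis arg_min_if_finite(1) arg_min_least)
  have wP: "w \<in> P" "0 < h w" "visible P T m w" using w by (auto simp: W_def)
  have low: "\<forall>x\<in>P. 0 < h x \<longrightarrow> visible P T m x \<longrightarrow> h w \<le> h x"
    using w(2) by (simp add: W_def)
  note L = lowest_visible_point[OF P uv m h wP low]
  have vu: "{v, u} \<in> T" "m \<in> open_segment v u" using uv m by (auto simp: insert_commute open_segment_commute)
  note R = lowest_visible_point[OF P vu h(1,3,2) wP low]
  have "x \<in> {u, v, w}" if x: "x \<in> convex hull {u, v, w}" "x \<in> P" for x
  proof -
    obtain a b c where abc: "0 \<le> a" "0 \<le> b" "0 \<le> c" "a + b + c = 1" "x = a *\<^sub>R u + b *\<^sub>R v + c *\<^sub>R w"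
      using x(1) unfolding convex_hull_3 by auto
    have a1: "a = 1 - b - c" using abc by simp
    have um: "v - m = - (u - m)" by (simp add: m_def algebra_simps flip: scaleR_add_left)
    have X: "x = m + (a - b) *\<^sub>R (u - m) + c *\<^sub>R (w - m)" "x = m + (b - a) *\<^sub>R (v - m) + c *\<^sub>R (w - m)"
    proof -
      have "x = m + a *\<^sub>R (u - m) + b *\<^sub>R (v - m) + c *\<^sub>R (w - m)"
        unfolding abc(5) a1 by (simp add: algebra_simps)
      then show "x = m + (a - b) *\<^sub>R (u - m) + c *\<^sub>R (w - m)" "x = m + (b - a) *\<^sub>R (v - m) + c *\<^sub>R (w - m)"
        unfolding um by (simp_all add: algebra_simps)
    qed
    show ?thesis
    \<comment> \<open>The sign of \<open>a - b\<close> tells which half contains x.\<close>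
    proof (cases "b \<le> a")
      case True
      have "coord1 m (u - m) (w - m) x = a - b" "coord2 m (u - m) (w - m) x = c"
        unfolding X(1) using coord1_eq[OF L(1)] coord2_eq[OF L(1)] by blast+
      then have "x = u \<or> x = w"
        by (intro L(2)[OF x(2)]) (use True abc(1-4) in linarith)+
      then show ?thesis by auto
    next
      case False
      have "coord1 m (v - m) (w - m) x = b - a" "coord2 m (v - m) (w - m) x = c"
        unfolding X(2) using coord1_eq[OF R(1)] coord2_eq[OF R(1)] by blast+
      then have "x = v \<or> x = w"
        by (intro R(2)[OF x(2)]) (use False abc(1-4) in linarith)+
      then show ?thesis by auto
    qed
  qed
  moreover have "{u, v, w} \<subseteq> convex hull {u, v, w}" by (rule hull_subset)
  ultimately have "convex hull {u, v, w} \<inter> P = {u, v, w}" using wP(1) E(1,2)[OF uv] by auto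
  then show thesis using that[OF wP(1)] wP(2) L(3) R(3) by (simp add: h_def)
qed

subsection \<open>Counting triangles\<close>

lemma cr_distinct: "cr (v - u) (w - u) \<noteq> 0 \<Longrightarrow> u \<noteq> v \<and> u \<noteq> w \<and> v \<noteq> w"
  by (auto simp: cr_def)

text \<open>An edge from u into the angle at u has its other end outside the empty triangle, hence
  beyond vw, and so it crosses the edge vw.\<close>

lemma corner_empty:
  assumes T: "noncross T T" and vw: "{v, w} \<in> T" and hull: "convex hull {u, v, w} \<inter> P = {u, v, w}"
    and c: "cr (v - u) (w - u) \<noteq> 0"
    and x: "{u, x} \<in> T" "x \<in> P" "x = u + \<alpha> *\<^sub>R (v - u) + \<beta> *\<^sub>R (w - u)" "0 < \<alpha>" "0 < \<beta>"
  shows False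
proof -
  let ?A = "v - u" and ?B = "w - u"
  have co: "coord1 u ?A ?B x = \<alpha>" "coord2 u ?A ?B x = \<beta>" using x(3) coord1_eq[OF c] coord2_eq[OF c] by auto
  have "x \<noteq> u" "x \<noteq> v" "x \<noteq> w" using co x(4,5) coord_simps[OF c, of u] by auto
  then have "x \<notin> convex hull {u, v, w}" using hull x(2) by blast
  moreover have "x = (1 - \<alpha> - \<beta>) *\<^sub>R u + \<alpha> *\<^sub>R v + \<beta> *\<^sub>R w" using x(3) by (simp add: algebra_simps)
  then have "x \<in> convex hull {u, v, w}" if "0 \<le> 1 - \<alpha> - \<beta>"
    unfolding convex_hull_3 using that x(4,5)
    by (intro CollectI exI[of _ "1 - \<alpha> - \<beta>"] exI[of _ \<alpha>] exI[of _ \<beta>]) auto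
  ultimately have "\<not> 0 \<le> 1 - \<alpha> - \<beta>" by blast
  then have s: "1 < \<alpha> + \<beta>" by simp
  \<comment> \<open>The point of the ray from u to x whose coordinates sum to 1, that is, its
    intersection with vw.\<close>
  define z where "z = (1 - 1 / (\<alpha> + \<beta>)) *\<^sub>R u + (1 / (\<alpha> + \<beta>)) *\<^sub>R x"
  have "z \<in> open_segment u x" unfolding in_segment z_def using s \<open>x \<noteq> u\<close>
    by (intro conjI exI[of _ "1 / (\<alpha> + \<beta>)"]) auto
  moreover have "z = (1 - \<beta> / (\<alpha> + \<beta>)) *\<^sub>R v + (\<beta> / (\<alpha> + \<beta>)) *\<^sub>R w"
  proof -
    have 1: "1 - \<beta> / (\<alpha> + \<beta>) = \<alpha> / (\<alpha> + \<beta>)" using s by (simp add: field_simps)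
    have "z = u + (\<alpha> / (\<alpha> + \<beta>)) *\<^sub>R ?A + (\<beta> / (\<alpha> + \<beta>)) *\<^sub>R ?B"
      unfolding z_def x(3) by (simp add: scaleR_add_right scaleR_diff_left)
    also have "\<dots> = (1 - \<alpha> / (\<alpha> + \<beta>) - \<beta> / (\<alpha> + \<beta>)) *\<^sub>R u + (\<alpha> / (\<alpha> + \<beta>)) *\<^sub>R v + (\<beta> / (\<alpha> + \<beta>)) *\<^sub>R w"
      by (simp add: algebra_simps)
    also have "1 - \<alpha> / (\<alpha> + \<beta>) - \<beta> / (\<alpha> + \<beta>) = 0" using s by (simp add: field_simps)
    finally show ?thesis unfolding 1 by simp
  qed
  then have "z \<in> open_segment v w" unfolding in_segment using s x(4,5) cr_distinct[OF c]
    by (intro conjI exI[of _ "\<beta> / (\<alpha> + \<beta>)"]) auto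
  ultimately have "{u, x} = {v, w}" using noncrossD[OF T x(1) vw] by blast
  then have "u = v \<or> u = w" by (auto simp: doubleton_eq_iff)
  then show False using c by (auto simp: cr_simps)
qed

text \<open>Of two edges leaving v in the same direction, the shorter would end inside the longer.
  The condition on N excludes opposite directions.\<close>

lemma same_ray:
  fixes N :: "real^2"
  assumes G: "geo_edges P G" and a: "{v, a} \<in> G" "{v, a'} \<in> G"
    and c: "cr (a - v) (a' - v) = 0" and N: "0 < (N \<bullet> (a - v)) * (N \<bullet> (a' - v))"
  shows "a = a'"
proof -
  note E = geo_edgesD[OF G]
  have a0: "a - v \<noteq> 0" using E(3)[OF a(1)] by auto
  then obtain k where k: "a' - v = k *\<^sub>R (a - v)" using cr_zero_parallel[OF c] by blast
  have "0 < k * (N \<bullet> (a - v))\<^sup>2" using N unfolding k by (simp add: power2_eq_square mult_ac)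
  then have k0: "0 < k" by (simp add: zero_less_mult_iff)
  have k': "a - v = (1 / k) *\<^sub>R (a' - v)" using k k0 by simp
  have "\<not> k < 1"
  proof
    assume "k < 1"
    then have "v + k *\<^sub>R (a - v) \<in> open_segment v (v + (a - v))"
      using k0 a0 by (intro mem_open_segment_add) auto
    then have "a' \<in> open_segment v a" unfolding k[symmetric] by simp
    then show False using E(4)[OF a(1)] E(2)[OF a(2)] by auto
  qed
  moreover have "\<not> 1 < k"
  proof
    assume "1 < k"
    then have "v + (1 / k) *\<^sub>R (a' - v) \<in> open_segment v (v + (a' - v))"
      using E(3)[OF a(2)] by (intro mem_open_segment_add) auto
    then have "a \<in> open_segment v a'" unfolding k'[symmetric] by simp
    then show False using E(4)[OF a(2)] E(2)[OF a(1)] by auto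
  qed
  ultimately have "k = 1" by simp
  then show ?thesis using k by simp
qed

text \<open>As t is an unordered set, noncollinearity is demanded of every listing of its three
  points; the last clause says that the triangle contains no other point of P.\<close>

definition triangles :: "(real^2) set \<Rightarrow> (real^2) set set \<Rightarrow> (real^2) set set" where
  "triangles P T = {t. t \<subseteq> P \<and> card t = 3 \<and> (\<forall>x\<in>t. \<forall>y\<in>t. x \<noteq> y \<longrightarrow> {x, y} \<in> T) \<and>
     (\<forall>a b c. t = {a, b, c} \<longrightarrow> cr (b - a) (c - a) \<noteq> 0) \<and> convex hull t \<inter> P = t}"

lemma trianglesI:
  assumes "{u, v, w} \<subseteq> P" "cr (v - u) (w - u) \<noteq> 0" "{u, v} \<in> T" "{v, w} \<in> T" "{u, w} \<in> T"
    "convex hull {u, v, w} \<inter> P = {u, v, w}"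
  shows "{u, v, w} \<in> triangles P T"
proof -
  have d: "u \<noteq> v" "u \<noteq> w" "v \<noteq> w" using cr_distinct[OF assms(2)] by auto
  have "cr (b - a) (c - a) \<noteq> 0" if "{u, v, w} = {a, b, c}" for a b c
  proof -
    have "card {a, b, c} = 3" using d unfolding that[symmetric] by simp
    then have d': "a \<noteq> b" "a \<noteq> c" "b \<noteq> c" by (auto simp: card_insert_if split: if_splits)
    have "u \<in> {a, b, c}" "v \<in> {a, b, c}" "w \<in> {a, b, c}" using that by blast+
    then have "(a = u \<and> b = v \<and> c = w) \<or> (a = u \<and> b = w \<and> c = v) \<or> (a = v \<and> b = u \<and> c = w) \<or>
      (a = v \<and> b = w \<and> c = u) \<or> (a = w \<and> b = u \<and> c = v) \<or> (a = w \<and> b = v \<and> c = u)"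
      using d by auto
    then show ?thesis using assms(2) by (elim disjE) (auto simp: cr_def algebra_simps)
  qed
  then show ?thesis using assms d unfolding triangles_def by (auto simp: insert_commute)
qed

lemma trianglesD:
  assumes "{a, v, b} \<in> triangles P T"
  shows "a \<in> P" "v \<in> P" "b \<in> P" "cr (a - v) (b - v) \<noteq> 0" "{v, a} \<in> T" "{v, b} \<in> T" "{a, b} \<in> T"
    "convex hull {v, a, b} \<inter> P = {v, a, b}"
proof -
  have eq: "{a, v, b} = {v, a, b}" by blast
  show c: "cr (a - v) (b - v) \<noteq> 0" using assms eq unfolding triangles_def by blast
  have "a \<noteq> v" "b \<noteq> v" "a \<noteq> b" using cr_distinct[OF c] by auto
  then show "a \<in> P" "v \<in> P" "b \<in> P" "{v, a} \<in> T" "{v, b} \<in> T" "{a, b} \<in> T"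
    "convex hull {v, a, b} \<inter> P = {v, a, b}"
    using assms unfolding triangles_def eq by auto
qed

lemma triangles_finite: "finite P \<Longrightarrow> finite (triangles P T)"
  by (rule finite_subset[of _ "Pow P"]) (auto simp: triangles_def)

text \<open>
  Sweeping along \<open>N\<close>, each triangle is charged to its middle vertex, on the side of that vertex
  on which the triangle lies.
\<close>

definition slot :: "real^2 \<Rightarrow> (real^2) set \<Rightarrow> real^2 \<Rightarrow> bool \<Rightarrow> bool" where
  "slot N t v s \<longleftrightarrow> (\<exists>a b. t = {a, v, b} \<and> N \<bullet> (a - v) < 0 \<and> 0 < N \<bullet> (b - v) \<and> s = (0 < cr (a - v) (b - v)))"

lemma slot_exists:
  assumes "t \<in> triangles P T" "inj_on (\<lambda>x. N \<bullet> x) P"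
  obtains v s where "v \<in> P" "slot N t v s"
proof -
  have "card t = 3" "t \<subseteq> P" using assms(1) by (auto simp: triangles_def)
  then obtain x y z where t: "t = {x, y, z}" "x \<noteq> y" "x \<noteq> z" "y \<noteq> z"
    by (auto simp: card_3_iff)
  have P: "x \<in> P" "y \<in> P" "z \<in> P" using \<open>t \<subseteq> P\<close> t by auto
  have ne: "N \<bullet> x \<noteq> N \<bullet> y" "N \<bullet> x \<noteq> N \<bullet> z" "N \<bullet> y \<noteq> N \<bullet> z"
    using assms(2) P t by (auto simp: inj_on_def)
  have mk: "\<exists>s. slot N t v s" if "t = {a, v, b}" "N \<bullet> a < N \<bullet> v" "N \<bullet> v < N \<bullet> b" for a v b
    unfolding slot_def using that
    by (intro exI[of _ "0 < cr (a - v) (b - v)"] exI[of _ a] exI[of _ b] conjI) (simp_all add: inner_diff_right)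
  consider "N \<bullet> x < N \<bullet> y \<and> N \<bullet> y < N \<bullet> z" | "N \<bullet> z < N \<bullet> y \<and> N \<bullet> y < N \<bullet> x"
    | "N \<bullet> y < N \<bullet> x \<and> N \<bullet> x < N \<bullet> z" | "N \<bullet> z < N \<bullet> x \<and> N \<bullet> x < N \<bullet> y"
    | "N \<bullet> x < N \<bullet> z \<and> N \<bullet> z < N \<bullet> y" | "N \<bullet> y < N \<bullet> z \<and> N \<bullet> z < N \<bullet> x"
    using ne by (meson linorder_less_linear)
  then have "\<exists>v\<in>P. \<exists>s. slot N t v s"
  proof cases
    case 1 then show ?thesis using mk[of x y z] t P by auto
  next
    case 2 then show ?thesis using mk[of z y x] t P by (auto simp: insert_commute)
  next
    case 3 then show ?thesis using mk[of y x z] t P by (auto simp: insert_commute)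
  next
    case 4 then show ?thesis using mk[of z x y] t P by (auto simp: insert_commute)
  next
    case 5 then show ?thesis using mk[of x z y] t P by (auto simp: insert_commute)
  next
    case 6 then show ?thesis using mk[of y z x] t P by (auto simp: insert_commute)
  qed
  then show thesis using that by blast
qed

text \<open>If va and \<open>va'\<close> differ in direction, equal orientation forces one of them
  to turn from the other towards that triangle's right end. Since it still points to the left, both
  its coordinates are positive, so it enters the corner of an empty triangle.\<close>

lemma slot_left_end_unique:
  fixes N :: "real^2"
  assumes T: "geo_edges P T" "noncross T T"
    and t: "{a, v, b} \<in> triangles P T" "{a', v, b'} \<in> triangles P T"
    and N: "N \<bullet> (a - v) < 0" "0 < N \<bullet> (b - v)" "N \<bullet> (a' - v) < 0" "0 < N \<bullet> (b' - v)"
    and s: "0 < cr (a - v) (b - v) * cr (a' - v) (b' - v)"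
  shows "a = a'"
proof -
  have no: False
    if t: "{a, v, b} \<in> triangles P T" "{a', v, b'} \<in> triangles P T"
      and N: "N \<bullet> (a - v) < 0" "0 < N \<bullet> (b - v)" "N \<bullet> (a' - v) < 0"
      and pos: "0 < cr (a - v) (a' - v) * cr (a - v) (b - v)" for a b a' b'
  proof -
    note t1 = trianglesD[OF t(1)] and t2 = trianglesD[OF t(2)]
    have c: "cr (a - v) (b - v) \<noteq> 0" by (rule t1(4))
    define \<alpha> where "\<alpha> = cr (a' - v) (b - v) / cr (a - v) (b - v)"
    define \<beta> where "\<beta> = cr (a - v) (a' - v) / cr (a - v) (b - v)"
    have x: "a' - v = \<alpha> *\<^sub>R (a - v) + \<beta> *\<^sub>R (b - v)"
      unfolding \<alpha>_def \<beta>_def by (rule cr_basis[OF c])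
    then have x': "a' = v + \<alpha> *\<^sub>R (a - v) + \<beta> *\<^sub>R (b - v)" by (simp add: algebra_simps)
    have \<beta>: "0 < \<beta>" using pos by (auto simp: \<beta>_def zero_less_divide_iff zero_less_mult_iff)
    have "\<alpha> * (N \<bullet> (a - v)) + \<beta> * (N \<bullet> (b - v)) < 0"
      using N(3) unfolding x by (simp only: inner_add_right inner_scaleR_right)
    moreover have "0 < \<beta> * (N \<bullet> (b - v))" using \<beta> N by simp
    ultimately have "\<alpha> * (N \<bullet> (a - v)) < 0" by linarith
    then have "0 < \<alpha>" using N(1) by (simp add: mult_less_0_iff)
    then show False using corner_empty[OF T(2) t1(7,8) c t2(5,1) x' _ \<beta>] by simp
  qed
  note t1 = trianglesD[OF t(1)] and t2 = trianglesD[OF t(2)]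
  have sym: "cr (a' - v) (a - v) = - cr (a - v) (a' - v)" by (rule cr_commute)
  have "cr (a - v) (a' - v) = 0"
  proof (rule ccontr)
    assume "cr (a - v) (a' - v) \<noteq> 0"
    then have "0 < cr (a - v) (a' - v) * cr (a - v) (b - v) \<or> 0 < cr (a' - v) (a - v) * cr (a' - v) (b' - v)"
      using s unfolding sym by (auto simp: zero_less_mult_iff mult_less_0_iff)
    then show False using no[OF t N(1,2,3)] no[OF t(2,1) N(3,4,1)] by blast
  qed
  moreover have "0 < (N \<bullet> (a - v)) * (N \<bullet> (a' - v))" using N by (simp add: mult_neg_neg)
  ultimately show ?thesis using same_ray[OF T(1) t1(5) t2(5)] by blast
qed

lemma slot_inj:
  assumes T: "geo_edges P T" "noncross T T"
    and t: "t \<in> triangles P T" "t' \<in> triangles P T" and s: "slot N t v s" "slot N t' v s"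
  shows "t = t'"
proof -
  obtain a b where ab: "t = {a, v, b}" "N \<bullet> (a - v) < 0" "0 < N \<bullet> (b - v)" "s = (0 < cr (a - v) (b - v))"
    using s(1) unfolding slot_def by blast
  obtain a' b' where ab': "t' = {a', v, b'}" "N \<bullet> (a' - v) < 0" "0 < N \<bullet> (b' - v)" "s = (0 < cr (a' - v) (b' - v))"
    using s(2) unfolding slot_def by blast
  have tt: "{a, v, b} \<in> triangles P T" "{a', v, b'} \<in> triangles P T" using t ab(1) ab'(1) by auto
  have pos: "0 < cr (a - v) (b - v) * cr (a' - v) (b' - v)"
    using trianglesD(4)[OF tt(1)] trianglesD(4)[OF tt(2)] ab(4) ab'(4)
    by (auto simp: zero_less_mult_iff)
  have "a = a'"
    by (rule slot_left_end_unique[OF T tt ab(2,3) ab'(2,3) pos])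
  moreover have "b = b'"
  \<comment> \<open>Reversing the sweep turns right ends into left ends and changes both
    orientations.\<close>
  proof (rule slot_left_end_unique[OF T, of b v a b' a' "- N"])
    show "{b, v, a} \<in> triangles P T" "{b', v, a'} \<in> triangles P T"
      using tt by (simp_all add: insert_commute)
    show "0 < cr (b - v) (a - v) * cr (b' - v) (a' - v)"
      using pos cr_commute[of "a - v" "b - v"] cr_commute[of "a' - v" "b' - v"] by simp
  qed (use ab ab' in auto)
  ultimately show ?thesis using ab(1) ab'(1) by simp
qed

text \<open>The Binet-Cauchy identity: it converts signs of inner products with N and M into an
  orientation.\<close>

lemma cr_binet: "cr N M * cr a b = (N \<bullet> a) * (M \<bullet> b) - (N \<bullet> b) * (M \<bullet> a)"
proof -
  obtain n1 n2 m1 m2 a1 a2 b1 b2 where "N$1 = n1" "N$2 = n2" "M$1 = m1" "M$2 = m2"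
    "a$1 = a1" "a$2 = a2" "b$1 = b1" "b$2 = b2" by simp
  then show ?thesis unfolding cr_def inner_2 by (simp add: algebra_simps)
qed

text \<open>Where \<open>P\<close> has a supporting line, no triangle lies beyond it.\<close>

lemma slot_supporting_line:
  assumes t: "t \<in> triangles P T" and s: "slot N t v s"
    and M: "\<forall>y\<in>P. M \<bullet> y \<le> M \<bullet> v"
  shows "cr N M = 0 \<or> s = (0 < cr N M)"
proof -
  obtain a b where ab: "t = {a, v, b}" "N \<bullet> (a - v) < 0" "0 < N \<bullet> (b - v)" "s = (0 < cr (a - v) (b - v))"
    using s(1) unfolding slot_def by blast
  note t1 = trianglesD[OF t[unfolded ab(1)]]
  have "M \<bullet> (a - v) \<le> 0" "M \<bullet> (b - v) \<le> 0" using M t1(1,3) by (auto simp: inner_diff_right)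
  then have "0 \<le> (N \<bullet> (a - v)) * (M \<bullet> (b - v))" "(N \<bullet> (b - v)) * (M \<bullet> (a - v)) \<le> 0"
    using ab(2,3) by (auto simp: mult_nonpos_nonpos mult_nonneg_nonpos)
  then have "0 \<le> cr N M * cr (a - v) (b - v)" unfolding cr_binet by simp
  then show ?thesis using t1(4) ab(4) by (auto simp: zero_le_mult_iff)
qed

text \<open>The first point p of the sweep is never a middle vertex. Leaving out its two slots makes
  the total 2(n - 1).\<close>

definition free_slots :: "real^2 \<Rightarrow> (real^2) set \<Rightarrow> (real^2) set set \<Rightarrow> real^2 \<Rightarrow> ((real^2) \<times> bool) set" where
  "free_slots N P T p = {(v, s). v \<in> P \<and> v \<noteq> p \<and> (\<forall>t\<in>triangles P T. \<not> slot N t v s)}"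

lemma slot_count:
  assumes P: "finite P" and T: "geo_edges P T" "noncross T T" and N: "inj_on (\<lambda>x. N \<bullet> x) P"
    and p: "p \<in> P" "\<forall>x\<in>P. N \<bullet> p \<le> N \<bullet> x"
  shows "card (triangles P T) + card (free_slots N P T p) \<le> 2 * (card P - 1)"
    "finite (free_slots N P T p)"
proof -
  let ?U = "(P - {p}) \<times> (UNIV :: bool set)"
  define \<sigma> where "\<sigma> t = (SOME vs. fst vs \<in> P \<and> slot N t (fst vs) (snd vs))" for t
  have \<sigma>: "fst (\<sigma> t) \<in> P \<and> slot N t (fst (\<sigma> t)) (snd (\<sigma> t))" if t: "t \<in> triangles P T" for t
    unfolding \<sigma>_def
  proof (rule someI_ex)
    obtain v s where "v \<in> P" "slot N t v s" using slot_exists[OF t N] .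
    then show "\<exists>vs. fst vs \<in> P \<and> slot N t (fst vs) (snd vs)" by (intro exI[of _ "(v, s)"]) simp
  qed
  have ne: "fst (\<sigma> t) \<noteq> p" if t: "t \<in> triangles P T" for t
  proof
    assume "fst (\<sigma> t) = p"
    then obtain a b where ab: "t = {a, p, b}" "N \<bullet> (a - p) < 0" using \<sigma>[OF t] unfolding slot_def by auto
    then have "a \<in> P" using t by (auto simp: triangles_def)
    then show False using p(2) ab(2) by (auto simp: inner_diff_right)
  qed
  have inj: "inj_on \<sigma> (triangles P T)"
  proof (rule inj_onI)
    fix t t' assume t: "t \<in> triangles P T" "t' \<in> triangles P T" "\<sigma> t = \<sigma> t'"
    show "t = t'"
      by (rule slot_inj[OF T t(1,2), of N "fst (\<sigma> t)" "snd (\<sigma> t)"]) (use \<sigma>[OF t(1)] \<sigma>[OF t(2)] t(3) in auto)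
  qed
  have sub: "\<sigma> ` triangles P T \<union> free_slots N P T p \<subseteq> ?U"
  proof (rule Un_least)
    show "\<sigma> ` triangles P T \<subseteq> ?U" by (rule image_subsetI) (use \<sigma> ne in \<open>simp add: mem_Times_iff\<close>)
  qed (auto simp: free_slots_def)
  have fin: "finite ?U" using P by simp
  then show ff: "finite (free_slots N P T p)" using sub finite_subset by blast
  have "\<sigma> ` triangles P T \<inter> free_slots N P T p = {}"
    using \<sigma> by (fastforce simp: free_slots_def)
  then have "card (\<sigma> ` triangles P T) + card (free_slots N P T p) = card (\<sigma> ` triangles P T \<union> free_slots N P T p)"
    using triangles_finite[OF P] ff by (intro card_Un_disjoint[symmetric]) auto
  also have "\<dots> \<le> card ?U" using fin sub by (rule card_mono)
  also have "card ?U = 2 * (card P - 1)" using P p(1) by (simp add: card_cartesian_product)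
  finally show "card (triangles P T) + card (free_slots N P T p) \<le> 2 * (card P - 1)"
    using card_image[OF inj] by simp
qed

text \<open>Rotation by a right angle: it turns the orientation test for a line into an inner
  product, as \<open>slot_supporting_line\<close> expects.\<close>

definition perp :: "real^2 \<Rightarrow> real^2" where
  "perp d = vector [- (d$2), d$1]"

lemma perp_inner: "perp d \<bullet> y = cr d y"
  by (simp add: perp_def inner_2 cr_def)

lemma cr_perp: "cr N (perp d) = N \<bullet> d"
  by (simp add: perp_def inner_2 cr_def)

lemma finite_attains_max:
  fixes f :: "'b \<Rightarrow> real"
  assumes "finite P" "P \<noteq> {}"
  shows "\<exists>q\<in>P. \<forall>x\<in>P. f x \<le> f q"
proof -
  have "finite (f ` P)" "f ` P \<noteq> {}" using assms by auto
  then have "Max (f ` P) \<in> f ` P" "\<forall>x\<in>P. f x \<le> Max (f ` P)" by auto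
  then show ?thesis by (metis imageE)
qed

text \<open>Nothing follows the last point q, so both its slots are free. The third is the outer
  slot of a point farthest from the line pq, where a parallel to pq supports P; this is where three
  noncollinear points are required.\<close>

lemma three_free_slots:
  assumes P: "finite P" and T: "geo_edges P T" "noncross T T" and N: "inj_on (\<lambda>x. N \<bullet> x) P"
    and p: "p \<in> P" "\<forall>x\<in>P. N \<bullet> p \<le> N \<bullet> x"
    and nc: "u \<in> P" "v \<in> P" "w \<in> P" "cr (v - u) (w - u) \<noteq> 0"
  shows "3 \<le> card (free_slots N P T p)"
proof -
  obtain q where q: "q \<in> P" "\<forall>x\<in>P. N \<bullet> x \<le> N \<bullet> q"
    using finite_attains_max[OF P, of "\<lambda>x. N \<bullet> x"] p(1) by blast
  have qp: "q \<noteq> p"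
  proof
    assume "q = p"
    then have "N \<bullet> x = N \<bullet> p" if "x \<in> P" for x using p(2) q(2) that by force
    then have "x = p" if "x \<in> P" for x using inj_onD[OF N _ that p(1)] that by blast
    then have "u = p" "v = p" "w = p" using nc(1-3) by blast+
    then show False using nc(4) by (simp add: cr_simps)
  qed
  have Npq: "0 < N \<bullet> (q - p)"
    using qp p q N by (auto simp: inj_on_def inner_diff_right less_le)
  have free_q: "(q, s) \<in> free_slots N P T p" for s
  proof -
    have False if t: "t \<in> triangles P T" "slot N t q s" for t
    proof -
      obtain a b where "t = {a, q, b}" "0 < N \<bullet> (b - q)" using t(2) unfolding slot_def by blast
      then show False using t(1) q(2) by (auto simp: triangles_def inner_diff_right)
    qed
    then show ?thesis using q qp by (auto simp: free_slots_def)
  qed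
  define d where "d = q - p"
  define h where "h x = cr d (x - p)" for x
  have d0: "d \<noteq> 0" using qp by (simp add: d_def)
  have "\<exists>x\<in>P. h x \<noteq> 0"
  proof (rule ccontr)
    assume "\<not> ?thesis"
    then have "cr d (u - p) = 0" "cr d (v - p) = 0" "cr d (w - p) = 0" using nc by (auto simp: h_def)
    then obtain k l j where "u - p = k *\<^sub>R d" "v - p = l *\<^sub>R d" "w - p = j *\<^sub>R d"
      using cr_zero_parallel d0 by meson
    moreover have "v - u = (v - p) - (u - p)" "w - u = (w - p) - (u - p)" by auto
    ultimately have "v - u = (l - k) *\<^sub>R d" "w - u = (j - k) *\<^sub>R d" by (simp_all add: algebra_simps)
    then show False using nc(4) by (simp add: cr_simps)
  qed
  then obtain x0 \<epsilon> where x0: "x0 \<in> P" "0 < \<epsilon> * h x0" "\<epsilon> = 1 \<or> \<epsilon> = -1"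
    by (metis linorder_neqE_linordered_idom mult_1 mult_minus_left neg_0_less_iff_less)
  \<comment> \<open>The sign \<open>\<epsilon>\<close> picks a side of the line pq that contains
    points, so that y is on neither p nor q.\<close>
  obtain y where y: "y \<in> P" "\<forall>x\<in>P. \<epsilon> * h x \<le> \<epsilon> * h y"
    using finite_attains_max[OF P, of "\<lambda>x. \<epsilon> * h x"] p(1) by blast
  have hy: "0 < \<epsilon> * h y" using x0 y by force
  have yne: "y \<noteq> p" "y \<noteq> q" using hy by (auto simp: h_def d_def cr_def)
  define M where "M = \<epsilon> *\<^sub>R perp d"
  have M: "\<forall>x\<in>P. M \<bullet> x \<le> M \<bullet> y"
    using y(2) by (auto simp: M_def perp_inner h_def cr_simps algebra_simps)
  have crM: "cr N M \<noteq> 0" using Npq x0(3) by (auto simp: M_def cr_simps cr_perp d_def)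
  have "(y, \<not> (0 < cr N M)) \<in> free_slots N P T p"
    using slot_supporting_line[OF _ _ M] crM y(1) yne by (fastforce simp: free_slots_def)
  then have "{(q, True), (q, False), (y, \<not> (0 < cr N M))} \<subseteq> free_slots N P T p"
    using free_q by auto
  moreover have "card {(q, True), (q, False), (y, \<not> (0 < cr N M))} = 3" using yne by simp
  ultimately show ?thesis using slot_count(2)[OF P T N p] by (metis card_mono)
qed

text \<open>The dart \<open>(u, v)\<close> stands for the left side of the edge \<open>uv\<close>; it is inner if \<open>P\<close> has points there.\<close>

definition darts :: "(real^2) set set \<Rightarrow> ((real^2) \<times> (real^2)) set" where
  "darts G = {(u, v). {u, v} \<in> G}"

definition inner_darts :: "(real^2) set \<Rightarrow> (real^2) set set \<Rightarrow> ((real^2) \<times> (real^2)) set" where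
  "inner_darts P G = {(u, v). {u, v} \<in> G \<and> (\<exists>x\<in>P. 0 < cr (v - u) (x - u))}"

lemma card_darts:
  assumes "finite G" "geo_edges P G"
  shows "finite (darts G)" "card (darts G) = 2 * card G"
proof -
  have "finite (darts G) \<and> card (darts G) = 2 * card G"
    using assms
  proof (induction G)
    case empty then show ?case by (simp add: darts_def)
  next
    case (insert e G)
    obtain a b where ab: "e = {a, b}" "a \<noteq> b" using insert.prems by (auto simp: geo_edges_def)
    have "darts (insert e G) = {(a, b), (b, a)} \<union> darts G"
      by (auto simp: darts_def ab doubleton_eq_iff)
    moreover have "{(a, b), (b, a)} \<inter> darts G = {}"
      using insert.hyps ab by (auto simp: darts_def insert_commute)
    moreover have "finite (darts G) \<and> card (darts G) = 2 * card G"
      using insert by (auto simp: geo_edges_def)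
    ultimately show ?case using insert.hyps ab by (simp add: card_Un_disjoint)
  qed
  then show "finite (darts G)" "card (darts G) = 2 * card G" by auto
qed

text \<open>Each inner dart has a triangle on its left, of which its edge is a side; so the darts
  are counted by incidences of edges and triangles.\<close>

lemma inner_dart_count:
  assumes P: "finite P" "max_plane P T" and G: "G \<subseteq> T"
    and c: "\<forall>t\<in>triangles P T. card {e \<in> G. e \<subseteq> t} \<le> c"
  shows "card (inner_darts P G) \<le> c * card (triangles P T)"
proof -
  have T: "geo_edges P T" "noncross T T" using P by (auto simp: max_plane_def)
  note E = geo_edgesD[OF T(1)]
  have fG: "finite G" using geo_edges_finite[OF P(1) T(1)] G finite_subset by blast
  define good where "good u v w \<longleftrightarrow> 0 < cr (v - u) (w - u) \<and> {u, v, w} \<in> triangles P T" for u v w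
  define W where "W u v = (SOME w. good u v w)" for u v
  have W: "good u v (W u v)" if uv: "(u, v) \<in> inner_darts P G" for u v
    unfolding W_def
  proof (rule someI_ex)
    have uvT: "{u, v} \<in> T" using uv G by (auto simp: inner_darts_def)
    obtain x where "x \<in> P" "0 < cr (v - u) (x - u)" using uv by (auto simp: inner_darts_def)
    from side_triangle[OF P uvT this] obtain w where "w \<in> P" "0 < cr (v - u) (w - u)" "{u, w} \<in> T" "{v, w} \<in> T"
      "convex hull {u, v, w} \<inter> P = {u, v, w}" .
    then have "good u v w" unfolding good_def using uvT E(1,2)[OF uvT] by (auto intro!: trianglesI)
    then show "\<exists>w. good u v w" by blast
  qed
  \<comment> \<open>The pair determines the dart: both darts of one edge cannot have the same
    triangle on their left.\<close>
  define \<psi> where "\<psi> = (\<lambda>(u, v). ({u, v, W u v}, {u, v}))"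
  have "inj_on \<psi> (inner_darts P G)"
  proof (rule inj_onI, clarify)
    fix u v u' v' assume d: "(u, v) \<in> inner_darts P G" "(u', v') \<in> inner_darts P G" and eq: "\<psi> (u, v) = \<psi> (u', v')"
    have w: "0 < cr (v - u) (W u v - u)" "0 < cr (v' - u') (W u' v' - u')" using W d by (auto simp: good_def)
    then have n: "W u v \<noteq> u" "W u v \<noteq> v" "W u' v' \<noteq> u'" "W u' v' \<noteq> v'" by (auto simp: cr_def)
    have e: "{u, v, W u v} = {u', v', W u' v'}" "{u, v} = {u', v'}" using eq by (auto simp: \<psi>_def)
    show "u = u' \<and> v = v'"
    proof (rule ccontr)
      assume "\<not> ?thesis"
      then have uv: "u = v'" "v = u'" using e(2) by (auto simp: doubleton_eq_iff)
      then have "W u v = W u' v'" using e(1) n by blast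
      then show False using w unfolding uv by (simp add: cr_def algebra_simps)
    qed
  qed
  moreover have "\<psi> ` inner_darts P G \<subseteq> (SIGMA t:triangles P T. {e \<in> G. e \<subseteq> t})"
    using W by (auto simp: \<psi>_def good_def) (auto simp: inner_darts_def)
  moreover have "finite (SIGMA t:triangles P T. {e \<in> G. e \<subseteq> t})" using triangles_finite[OF P(1)] fG by auto
  ultimately have "card (inner_darts P G) \<le> card (SIGMA t:triangles P T. {e \<in> G. e \<subseteq> t})"
    using card_inj_on_le by blast
  also have "\<dots> = (\<Sum>t\<in>triangles P T. card {e \<in> G. e \<subseteq> t})"
    using triangles_finite[OF P(1)] fG by (intro card_SigmaI) auto
  also have "\<dots> \<le> (\<Sum>t\<in>triangles P T. c)" using c by (intro sum_mono) auto
  finally show ?thesis by (simp add: mult.commute)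
qed

text \<open>The line of an outer dart supports P, which frees the slot on its left at either end.
  The later end is charged, since it is never p. Two outer darts charged to one slot lie on the same
  ray from their common end, and hence are equal.\<close>

lemma outer_dart_count:
  assumes P: "finite P" and T: "geo_edges P T" "noncross T T" and N: "inj_on (\<lambda>x. N \<bullet> x) P"
    and p: "p \<in> P" "\<forall>x\<in>P. N \<bullet> p \<le> N \<bullet> x" and G: "geo_edges P G"
  shows "card (darts G - inner_darts P G) \<le> card (free_slots N P T p)"
proof -
  note E = geo_edgesD[OF G]
  \<comment> \<open>Both cases choose the end with the larger value of N. With N pointing right,
    \<open>False\<close> stands for triangles above the vertex and \<open>True\<close> for those
    below.\<close>
  define \<psi> where "\<psi> = (\<lambda>(u, v). if N \<bullet> u < N \<bullet> v then (v, False) else (u, True))"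
  let ?O = "darts G - inner_darts P G"
  have O: "{u, v} \<in> G" "u \<in> P" "v \<in> P" "u \<noteq> v" "N \<bullet> u \<noteq> N \<bullet> v" "\<forall>x\<in>P. cr (v - u) (x - u) \<le> 0" if "(u, v) \<in> ?O" for u v
  proof -
    show uv: "{u, v} \<in> G" using that by (auto simp: darts_def)
    show "u \<in> P" "v \<in> P" "u \<noteq> v" using E[OF uv] by auto
    then show "N \<bullet> u \<noteq> N \<bullet> v" using N by (auto simp: inj_on_def)
    show "\<forall>x\<in>P. cr (v - u) (x - u) \<le> 0" using that by (auto simp: darts_def inner_darts_def not_less)
  qed
  have "inj_on \<psi> ?O"
  proof (rule inj_onI, clarify)
    fix u v u' v' assume d: "(u, v) \<in> darts G" "(u, v) \<notin> inner_darts P G" "(u', v') \<in> darts G"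
      "(u', v') \<notin> inner_darts P G" and eq: "\<psi> (u, v) = \<psi> (u', v')"
    then have "(u, v) \<in> ?O" "(u', v') \<in> ?O" by auto
    note o = O[OF this(1)] and o' = O[OF this(2)]
    show "u = u' \<and> v = v'"
    proof (cases "N \<bullet> u < N \<bullet> v")
      case True
      then have v: "v = v'" "N \<bullet> u' < N \<bullet> v'" using eq by (auto simp: \<psi>_def split: if_splits)
      have "cr (v - u) (u' - u) \<le> 0" "cr (v - u') (u - u') \<le> 0" using o(6) o'(6) o(2) o'(2) v by auto
      then have "cr (u - v) (u' - v) = 0" by (simp add: cr_def algebra_simps)
      moreover have "{v, u} \<in> G" "{v, u'} \<in> G" using o(1) o'(1) v by (auto simp: insert_commute)
      moreover have "0 < (N \<bullet> (u - v)) * (N \<bullet> (u' - v))"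
        using True v by (auto simp: inner_diff_right intro!: mult_neg_neg)
      ultimately show ?thesis using same_ray[OF G] v by blast
    next
      case False
      then have u: "u = u'" "N \<bullet> v' < N \<bullet> u'" "N \<bullet> v < N \<bullet> u"
        using eq o(5) o'(5) by (auto simp: \<psi>_def split: if_splits)
      have "cr (v - u) (v' - u) \<le> 0" "cr (v' - u) (v - u) \<le> 0" using o(6) o'(6) o(3) o'(3) u by auto
      then have "cr (v - u) (v' - u) = 0" by (simp add: cr_def algebra_simps)
      moreover have "{u, v} \<in> G" "{u, v'} \<in> G" using o(1) o'(1) u by auto
      moreover have "0 < (N \<bullet> (v - u)) * (N \<bullet> (v' - u))"
        using u by (auto simp: inner_diff_right intro!: mult_neg_neg)
      ultimately show ?thesis using same_ray[OF G] u by blast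
    qed
  qed
  moreover have "\<psi> ` ?O \<subseteq> free_slots N P T p"
  proof clarify
    fix a b u v assume d: "(u, v) \<in> darts G" "(u, v) \<notin> inner_darts P G" and ab: "(a, b) = \<psi> (u, v)"
    then have "(u, v) \<in> ?O" by auto
    note o = O[OF this]
    define M where "M = perp (v - u)"
    have Mu: "\<forall>x\<in>P. M \<bullet> x \<le> M \<bullet> u" using o(6) by (auto simp: M_def perp_inner cr_simps)
    have Mv: "M \<bullet> v = M \<bullet> u" by (simp add: M_def perp_inner cr_def algebra_simps)
    have crM: "cr N M = N \<bullet> v - N \<bullet> u" by (simp add: M_def cr_perp inner_diff_right)
    show "(a, b) \<in> free_slots N P T p"
    proof (cases "N \<bullet> u < N \<bullet> v")
      case True
      then have "a = v" "b = False" using ab by (auto simp: \<psi>_def)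
      moreover have "v \<noteq> p" using True p(2) o(2) by force
      moreover have "\<not> slot N t v False" if "t \<in> triangles P T" for t
        using slot_supporting_line[OF that, of N v False M] Mu Mv crM True by auto
      ultimately show ?thesis using o(3) by (auto simp: free_slots_def)
    next
      case False
      then have "a = u" "b = True" using ab by (auto simp: \<psi>_def)
      moreover have "u \<noteq> p" using False o(5) p(2) o(3) by force
      moreover have "\<not> slot N t u True" if "t \<in> triangles P T" for t
        using slot_supporting_line[OF that, of N u True M] Mu crM False o(5) by auto
      ultimately show ?thesis using o(2) by (auto simp: free_slots_def)
    qed
  qed
  ultimately show ?thesis using slot_count(2)[OF P T N p] card_inj_on_le by blast
qed

section \<open>The bound for plane bipartite graphs\<close>

lemma generic_direction:
  assumes "finite (P :: (real^2) set)"
  obtains N :: "real^2" where "inj_on (\<lambda>x. N \<bullet> x) P"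
proof -
  \<comment> \<open>The values of t for which two points of different second coordinate tie. Pairs
    with equal second coordinate contribute the value 0 of division by zero, which merely forbids
    one more t.\<close>
  define S where "S = (\<lambda>(x, y). - ((x$1 - y$1) / (x$2 - y$2))) ` (P \<times> P)"
  have "finite S" using assms by (simp add: S_def)
  then obtain t where t: "t \<notin> S" using ex_new_if_finite infinite_UNIV_char_0 by blast
  have "inj_on (\<lambda>x. vector [1, t] \<bullet> x) P"
  proof (rule inj_onI)
    fix x y assume xy: "x \<in> P" "y \<in> P" "(vector [1, t] :: real^2) \<bullet> x = vector [1, t] \<bullet> y"
    then have eq: "x$1 - y$1 + t * (x$2 - y$2) = 0" by (simp add: inner_2 algebra_simps)
    have "x$2 = y$2"
    proof (rule ccontr)
      assume "x$2 \<noteq> y$2"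
      then have "t = - ((x$1 - y$1) / (x$2 - y$2))" using eq by (simp add: field_simps)
      then show False using t xy by (auto simp: S_def)
    qed
    then show "x = y" using eq by (simp add: vec_eq_iff forall_2)
  qed
  then show thesis by (rule that)
qed

lemma plane_bipartite_bound:
  fixes col :: "real^2 \<Rightarrow> bool"
  assumes P: "finite P" "3 \<le> card P" and G: "geo_edges P G" "noncross G G"
    and col: "\<And>u v. {u, v} \<in> G \<Longrightarrow> col u \<noteq> col v"
  shows "card G + 4 \<le> 2 * card P"
proof -
  obtain T where T: "G \<subseteq> T" "max_plane P T" using max_plane_extend[OF P(1) G] .
  have T2: "geo_edges P T" "noncross T T" using T by (auto simp: max_plane_def)
  obtain N :: "real^2" where N: "inj_on (\<lambda>x. N \<bullet> x) P" using generic_direction[OF P(1)] .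
  obtain p where p: "p \<in> P" "\<forall>x\<in>P. N \<bullet> p \<le> N \<bullet> x"
    using finite_attains_max[OF P(1), of "\<lambda>x. - (N \<bullet> x)"] P(2) by force
  have fG: "finite G" using geo_edges_finite[OF P(1) G(1)] .
  have two: "card {e \<in> G. e \<subseteq> t} \<le> 2" if t: "t \<in> triangles P T" for t
  proof -
    have "card t = 3" using t by (auto simp: triangles_def)
    then obtain x y z where xyz: "t = {x, y, z}" "x \<noteq> y" "x \<noteq> z" "y \<noteq> z" by (auto simp: card_3_iff)
    have sub: "{e \<in> G. e \<subseteq> t} \<subseteq> {{x, y}, {x, z}, {y, z}} \<inter> G"
    proof (rule subsetI)
      fix e assume "e \<in> {e \<in> G. e \<subseteq> t}"
      then have e: "e \<in> G" "e \<subseteq> t" by auto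
      obtain a b where "e = {a, b}" "a \<noteq> b" using e(1) G(1) unfolding geo_edges_def by blast
      then show "e \<in> {{x, y}, {x, z}, {y, z}} \<inter> G" using e xyz by (auto simp: insert_commute)
    qed
    have "\<exists>e\<in>{{x, y}, {x, z}, {y, z}}. e \<notin> G" using col[of x y] col[of x z] col[of y z] by blast
    then obtain e where e: "e \<in> {{x, y}, {x, z}, {y, z}}" "e \<notin> G" by blast
    then have "{e \<in> G. e \<subseteq> t} \<subseteq> {{x, y}, {x, z}, {y, z}} - {e}" using sub by blast
    then have "card {e \<in> G. e \<subseteq> t} \<le> card ({{x, y}, {x, z}, {y, z}} - {e})" by (intro card_mono) auto
    also have "\<dots> = card {{x, y}, {x, z}, {y, z}} - 1" using e by (intro card_Diff_singleton) auto
    also have "\<dots> \<le> 2" using card_insert_le_m1[of 3 "{{x, z}, {y, z}}"] by (simp add: card_insert_if)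
    finally show ?thesis .
  qed
  have D: "finite (darts G)" "card (darts G) = 2 * card G" using card_darts[OF fG G(1)] by auto
  have sub: "inner_darts P G \<subseteq> darts G" by (auto simp: inner_darts_def darts_def)
  have split: "2 * card G = card (inner_darts P G) + card (darts G - inner_darts P G)"
    using D sub by (metis card_Diff_subset card_mono finite_subset le_add_diff_inverse)
  have inner: "card (inner_darts P G) \<le> 2 * card (triangles P T)"
    using inner_dart_count[OF P(1) T(2,1)] two by blast
  have outer: "card (darts G - inner_darts P G) \<le> card (free_slots N P T p)"
    by (rule outer_dart_count[OF P(1) T2 N p G(1)])
  have slots: "card (triangles P T) + card (free_slots N P T p) \<le> 2 * (card P - 1)"
    by (rule slot_count[OF P(1) T2 N p])
  show ?thesis
  proof (cases "\<exists>u\<in>P. \<exists>v\<in>P. \<exists>w\<in>P. cr (v - u) (w - u) \<noteq> 0")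
    case True
    then have "3 \<le> card (free_slots N P T p)" using three_free_slots[OF P(1) T2 N p] by blast
    \<comment> \<open>With t triangles and f free slots, 2|G| \<le> 2t + f = 2(t + f) - f \<le> 4(n
      - 1) - 3. The right side is odd, so |G| \<le> 2n - 4.\<close>
    then show ?thesis using split inner outer slots P(2) by linarith
  next
    \<comment> \<open>All points are collinear, so no dart is inner and 2|G| \<le> 2(n - 1). Now n -
      1 \<le> 2n - 4 because n \<ge> 3.\<close>
    case False
    have "\<not> (u, v) \<in> inner_darts P G" for u v
    proof
      assume "(u, v) \<in> inner_darts P G"
      then obtain x where x: "{u, v} \<in> G" "x \<in> P" "0 < cr (v - u) (x - u)" by (auto simp: inner_darts_def)
      then show False using False geo_edgesD(1,2)[OF G(1) x(1)] by (metis less_irrefl)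
    qed
    then have "inner_darts P G = {}" by auto
    then show ?thesis using split outer slots P(2) by simp
  qed
qed

subsection \<open>Angles between crossed edges\<close>

lemma coord1_swap: "coord1 u B A = coord2 u A B" and coord2_swap: "coord2 u B A = coord1 u A B"
  unfolding coord1_def coord2_def fun_eq_iff using cr_commute[of A B] cr_commute[of A "_ - u"] cr_commute[of B "_ - u"]
  by simp_all

text \<open>
  The region lies in the angle between \<open>A\<close> and \<open>B\<close> at \<open>u\<close>, in front of the perpendiculars to the two
  rays at \<open>u + sA\<close> and \<open>u + s'B\<close>. The weights make the depth increase inwards along both
  perpendiculars (\<open>f_increasing\<close> below), as well as along the two rays.
\<close>

definition depth :: "real^2 \<Rightarrow> real^2 \<Rightarrow> real^2 \<Rightarrow> real^2 \<Rightarrow> real" where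
  "depth u A B p = norm A * coord1 u A B p + norm B * coord2 u A B p"

definition slack :: "real^2 \<Rightarrow> real^2 \<Rightarrow> real \<Rightarrow> real^2 \<Rightarrow> real" where
  "slack u A s p = s * (A \<bullet> A) - (p - u) \<bullet> A"

definition region :: "real^2 \<Rightarrow> real^2 \<Rightarrow> real^2 \<Rightarrow> real \<Rightarrow> real \<Rightarrow> real^2 \<Rightarrow> bool" where
  "region u A B s s' p \<longleftrightarrow> 0 \<le> coord1 u A B p \<and> 0 \<le> coord2 u A B p \<and> 0 \<le> slack u A s p \<and> 0 \<le> slack u B s' p"

lemma depth_swap: "depth u B A = depth u A B"
  unfolding depth_def fun_eq_iff coord1_swap[of u B A] coord2_swap[of u B A] by simp

lemma region_swap: "region u B A s' s = region u A B s s'"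
  unfolding region_def fun_eq_iff coord1_swap[of u B A] coord2_swap[of u B A] by auto

lemma aff_depth: "aff (depth u A B)"
  unfolding depth_def[abs_def] by (intro aff_add aff_mult aff_coord1 aff_coord2)

lemma aff_slack: "aff (slack u A s)"
  unfolding slack_def[abs_def] by (intro aff_diff aff_const aff_inner)

text \<open>\<open>Bl\<close> stands for the crossed blue edges, \<open>Gr\<close> for the non-blue
  ones, called green, and \<open>R\<close> for edges crossing neither. The green edge with ends
  \<open>y0\<close>, y is the one crossing uv nearest to u, and y is its end on the side of w; the
  primed data play this part for uw. The symmetry \<open>swap\<close> transfers every fact about uv
  to uw.\<close>

locale blue_corner =
  fixes P :: "(real^2) set" and Bl Gr R :: "(real^2) set set"
    and u v w y0 y y0' y' :: "real^2" and s s' :: real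
  assumes fin: "finite P"
    and geo: "geo_edges P Bl" "geo_edges P Gr" "geo_edges P R"
    and nc: "noncross Bl Bl" "noncross Gr Gr" "noncross R R" "noncross R Bl" "noncross R Gr"
    and orth: "\<forall>a b c d. {a, b} \<in> Bl \<longrightarrow> {c, d} \<in> Gr \<longrightarrow> open_segment a b \<inter> open_segment c d \<noteq> {} \<longrightarrow>
      (b - a) \<bullet> (d - c) = 0"
    and corner: "{u, v} \<in> Bl" "{u, w} \<in> Bl" "cr (v - u) (w - u) \<noteq> 0"
    and green: "0 < s" "s < 1" "{y0, y} \<in> Gr" "u + s *\<^sub>R (v - u) \<in> open_segment y0 y"
      "0 < coord2 u (v - u) (w - u) y"
      "\<forall>c d t. {c, d} \<in> Gr \<longrightarrow> 0 < t \<longrightarrow> t < 1 \<longrightarrow> u + t *\<^sub>R (v - u) \<in> open_segment c d \<longrightarrow> s \<le> t"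
    and green': "0 < s'" "s' < 1" "{y0', y'} \<in> Gr" "u + s' *\<^sub>R (w - u) \<in> open_segment y0' y'"
      "0 < coord2 u (w - u) (v - u) y'"
      "\<forall>c d t. {c, d} \<in> Gr \<longrightarrow> 0 < t \<longrightarrow> t < 1 \<longrightarrow> u + t *\<^sub>R (w - u) \<in> open_segment c d \<longrightarrow> s' \<le> t"
begin

lemma swap: "blue_corner P Bl Gr R u w v y0' y' y0 y s' s"
proof -
  have "cr (w - u) (v - u) \<noteq> 0" using corner(3) cr_commute[of "v - u" "w - u"] by simp
  then show ?thesis
    by unfold_locales (use fin geo nc orth corner green green' in \<open>auto\<close>)
qed

abbreviation "A \<equiv> v - u"
abbreviation "B \<equiv> w - u"
abbreviation "al \<equiv> coord1 u A B"
abbreviation "be \<equiv> coord2 u A B"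
abbreviation "k1 \<equiv> slack u A s"
abbreviation "k2 \<equiv> slack u B s'"
abbreviation "f \<equiv> depth u A B"
abbreviation "D \<equiv> region u A B s s'"

lemma uP: "u \<in> P" and yP: "y \<in> P"
  and A0: "A \<noteq> 0" and B0: "B \<noteq> 0"
  using geo_edgesD[OF geo(1) corner(1)] geo_edgesD[OF geo(1) corner(2)] geo_edgesD[OF geo(2) green(3)] by auto

text \<open>The entries of the Gram matrix of A and B, whose determinant is positive by Lagrange's
  identity.\<close>

definition "aa = A \<bullet> A"
definition "ab = A \<bullet> B"
definition "bb = B \<bullet> B"

lemma AA: "0 < aa" and BB: "0 < bb"
  using A0 B0 by (auto simp: aa_def bb_def)

lemma det: "0 < aa * bb - ab\<^sup>2"
  unfolding lagrange_2 aa_def ab_def bb_def using corner(3) by simp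

lemma co: "p = u + al p *\<^sub>R A + be p *\<^sub>R B"
  by (rule coords[OF corner(3)])

lemma k1_eq: "k1 p = s * aa - (al p * aa + be p * ab)"
  and k2_eq: "k2 p = s' * bb - (al p * ab + be p * bb)"
proof -
  have "p - u = al p *\<^sub>R A + be p *\<^sub>R B" using co[of p] by (simp add: algebra_simps)
  then have "(p - u) \<bullet> A = (al p *\<^sub>R A + be p *\<^sub>R B) \<bullet> A" "(p - u) \<bullet> B = (al p *\<^sub>R A + be p *\<^sub>R B) \<bullet> B"
    by simp_all
  then have "(p - u) \<bullet> A = al p * aa + be p * ab" "(p - u) \<bullet> B = al p * ab + be p * bb"
    unfolding aa_def ab_def bb_def by (simp_all only: inner_add_left inner_scaleR_left inner_commute[of B A])
  then show "k1 p = s * aa - (al p * aa + be p * ab)" "k2 p = s' * bb - (al p * ab + be p * bb)"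
    by (simp_all add: slack_def aa_def bb_def)
qed

lemma A_orth: "A \<bullet> (y - y0) = 0"
proof -
  have "u + s *\<^sub>R A \<in> open_segment u v"
    using mem_open_segment_add[OF green(1,2) A0, of u] by simp
  then show ?thesis using orth corner(1) green(3,4) by blast
qed

lemma y_ne: "y - y0 \<noteq> 0"
  using geo_edgesD(3)[OF geo(2) green(3)] by simp

text \<open>The green edge is perpendicular to A and passes through u + sA, so it lies on the line
  where \<open>k1\<close> vanishes.\<close>

lemma k1_green:
  assumes "p \<in> open_segment y0 y \<or> p = y"
  shows "k1 p = 0"
proof -
  have on: "(p - u) \<bullet> A = (y - u) \<bullet> A" if "p \<in> open_segment y0 y \<or> p = y" for p
  proof -
    obtain t where t: "p = (1 - t) *\<^sub>R y0 + t *\<^sub>R y"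
    proof (cases "p = y")
      case True then show thesis using that[of 1] by simp
    next
      case False
      then show thesis using that \<open>p \<in> open_segment y0 y \<or> p = y\<close> by (auto simp: in_segment)
    qed
    have "p - u = (y - u) - (1 - t) *\<^sub>R (y - y0)" unfolding t by (simp add: algebra_simps)
    then have "(p - u) \<bullet> A = (y - u) \<bullet> A - (1 - t) * (A \<bullet> (y - y0))"
      by (simp only: inner_diff_left[of "y - u"] inner_scaleR_left inner_commute[of "y - y0"])
    then show ?thesis unfolding A_orth by simp
  qed
  have "(y - u) \<bullet> A = (u + s *\<^sub>R A - u) \<bullet> A" using on[of "u + s *\<^sub>R A"] green(4) by simp
  then have "(y - u) \<bullet> A = s * (A \<bullet> A)" by simp
  then show ?thesis using on[OF assms] by (simp add: slack_def)
qed

lemma al_line: "k1 p = 0 \<Longrightarrow> al p = s - be p * (ab / aa)"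
  using AA unfolding k1_eq by (simp add: field_simps)

lemma line_eqI: "k1 p = 0 \<Longrightarrow> k1 p' = 0 \<Longrightarrow> be p = be p' \<Longrightarrow> p = p'"
  using co[of p] co[of p'] al_line[of p] al_line[of p'] by simp

text \<open>On that line \<open>be\<close> is a coordinate, with value 0 at the crossing point with
  uv. Hence everything from there up to y is on the edge.\<close>

lemma on_green:
  assumes "k1 p = 0" "0 \<le> be p" "be p < be y"
  shows "p \<in> open_segment y0 y"
proof -
  define t where "t = be p / be y"
  have t: "0 \<le> t" "t < 1" using assms green(5) by (auto simp: t_def)
  define p' where "p' = (1 - t) *\<^sub>R (u + s *\<^sub>R A) + t *\<^sub>R y"
  have p': "p' \<in> open_segment y0 y" unfolding p'_def by (rule open_segment_move[OF green(4) _ t]) simp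
  have "be (u + s *\<^sub>R A) = 0" using coord2_eq[OF corner(3), of u s 0] by simp
  then have "be p' = t * be y" unfolding p'_def by (simp add: affD[OF aff_coord2])
  also have "\<dots> = be p" using green(5) by (simp add: t_def)
  finally have "p' = p" using k1_green p' assms(1) by (intro line_eqI) auto
  then show ?thesis using p' by simp
qed

lemma k2_line:
  assumes "k1 p = 0"
  shows "k2 p = s' * bb - s * ab - be p * ((aa * bb - ab\<^sup>2) / aa)"
  using AA unfolding k2_eq al_line[OF assms] by (simp add: field_simps power2_eq_square)

lemma f_line:
  assumes "k1 p = 0"
  shows "f p = norm A * s + be p * (norm B - ab / norm A)"
proof -
  have "aa = norm A * norm A" by (simp add: aa_def dot_square_norm power2_eq_square)
  then show ?thesis using A0 unfolding depth_def al_line[OF assms] by (simp add: field_simps)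
qed

text \<open>The strict Cauchy-Schwarz inequality; by \<open>f_line\<close> this number is the slope
  of the depth along the perpendicular to uv.\<close>

lemma f_increasing: "0 < norm B - ab / norm A"
proof -
  have "ab\<^sup>2 < (norm A * norm B)\<^sup>2"
    using det by (simp add: aa_def bb_def power_mult_distrib dot_square_norm)
  then have "ab < norm A * norm B" by (rule power2_less_imp_less) simp
  then show ?thesis using A0 by (simp add: field_simps)
qed

text \<open>A green edge crossing both uv and uw would be perpendicular to two independent
  directions.\<close>

lemma green_not_both:
  assumes "p \<in> open_segment y0 y" "p \<in> open_segment u w"
  shows False
proof -
  have "B \<bullet> (y - y0) = 0" using orth corner(2) green(3) assms by blast
  then show False using orthogonal_both_zero[OF corner(3) A_orth] y_ne by blast
qed

text \<open>Together with \<open>\<beta>0\<close>, the coordinates of the point where the two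
  perpendiculars meet, by Cramer's rule for the Gram matrix.\<close>

definition "\<alpha>0 = (s * aa * bb - s' * bb * ab) / (aa * bb - ab\<^sup>2)"
definition "\<beta>0 = (s' * bb * aa - s * aa * ab) / (aa * bb - ab\<^sup>2)"

lemma meet_A: "\<alpha>0 * aa + \<beta>0 * ab = s * aa"
  and meet_B: "\<alpha>0 * ab + \<beta>0 * bb = s' * bb"
proof -
  define d where "d = aa * bb - ab\<^sup>2"
  have d: "d \<noteq> 0" using det by (simp add: d_def)
  have "d * \<alpha>0 = s * aa * bb - s' * bb * ab"
    "d * \<beta>0 = s' * bb * aa - s * aa * ab"
    using d unfolding \<alpha>0_def \<beta>0_def d_def[symmetric] by simp_all
  note e = this
  have "d * (\<alpha>0 * aa + \<beta>0 * ab) = (d * \<alpha>0) * aa + (d * \<beta>0) * ab"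
    by (simp add: algebra_simps)
  also have "\<dots> = d * (s * aa)" unfolding e by (simp add: d_def algebra_simps power2_eq_square)
  finally show "\<alpha>0 * aa + \<beta>0 * ab = s * aa" using d by simp
  have "d * (\<alpha>0 * ab + \<beta>0 * bb) = (d * \<alpha>0) * ab + (d * \<beta>0) * bb"
    by (simp add: algebra_simps)
  also have "\<dots> = d * (s' * bb)" unfolding e by (simp add: d_def algebra_simps power2_eq_square)
  finally show "\<alpha>0 * ab + \<beta>0 * bb = s' * bb" using d by simp
qed

lemma k2_line_meet:
  assumes "k1 p = 0"
  shows "k2 p = (\<beta>0 - be p) * ((aa * bb - ab\<^sup>2) / aa)"
proof -
  define z where "z = u + \<alpha>0 *\<^sub>R A + \<beta>0 *\<^sub>R B"
  have z: "al z = \<alpha>0" "be z = \<beta>0" unfolding z_def by (rule coord1_eq[OF corner(3)], rule coord2_eq[OF corner(3)])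
  have "k1 z = 0" "k2 z = 0" unfolding k1_eq k2_eq z using meet_A meet_B by simp_all
  then have "s' * bb - s * ab = \<beta>0 * ((aa * bb - ab\<^sup>2) / aa)"
    using k2_line[of z] z by simp
  then show ?thesis unfolding k2_line[OF assms] by (simp only: left_diff_distrib)
qed

text \<open>Followed from uv, the first perpendicular leaves the region either across the ray of uw
  or at the meeting point. On the former route the green edge would cross uw as well as uv, so an
  edge whose end y is outside the region runs past the meeting point.\<close>

lemma leaves_region:
  assumes "\<not> D y"
  shows "\<beta>0 < be y" "0 \<le> \<alpha>0"
proof -
  define m where "m = ab / aa"
  have ky: "k1 y = 0" using k1_green by simp
  have aly: "al y = s - be y * m" using al_line[OF ky] by (simp add: m_def)
  have \<alpha>0: "\<alpha>0 = s - \<beta>0 * m" using meet_A AA by (simp add: m_def field_simps)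
  have pos: "0 < (aa * bb - ab\<^sup>2) / aa" using det AA by simp
  have not_D: "al y < 0 \<or> \<beta>0 < be y"
  proof (rule ccontr)
    assume "\<not> ?thesis"
    then have "0 \<le> al y" "0 \<le> \<beta>0 - be y" by auto
    moreover have "0 \<le> k2 y" unfolding k2_line_meet[OF ky]
      by (rule mult_nonneg_nonneg) (use calculation pos in linarith)+
    ultimately have "D y" using ky green(5) unfolding region_def by simp
    then show False using assms by simp
  qed
  \<comment> \<open>The perpendicular meets the ray of uw at u + (s/m)B. If this is not after the
    meeting point, then \<open>k2\<close> is nonnegative there, whence s/m \<le> s' < 1 and the
    point is interior to uw.\<close>
  have hit: False if "0 < m" "s < be y * m" "s \<le> \<beta>0 * m"
  proof -
    define p where "p = u + (s / m) *\<^sub>R B"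
    have p: "al p = 0" "be p = s / m"
      using coord1_eq[OF corner(3), of u 0 "s / m"] coord2_eq[OF corner(3), of u 0 "s / m"] by (simp_all add: p_def)
    have "k1 p = 0" using that(1) AA unfolding k1_eq p by (simp add: m_def field_simps)
    moreover have "0 \<le> be p" "be p < be y"
      unfolding p using that green(1) by (simp_all add: pos_divide_less_eq)
    ultimately have 1: "p \<in> open_segment y0 y" by (rule on_green)
    have "be p \<le> \<beta>0" unfolding p using that by (simp add: pos_divide_le_eq)
    then have "0 \<le> k2 p" unfolding k2_line_meet[OF \<open>k1 p = 0\<close>]
      by (intro mult_nonneg_nonneg) (use pos in linarith)+
    then have "be p \<le> s'" using BB unfolding k2_eq p(1) by simp
    then have "s / m < 1" unfolding p using green'(2) by linarith
    moreover have "0 < s / m" using that(1) green(1) by simp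
    ultimately have "p \<in> open_segment u (u + B)"
      unfolding p_def by (intro mem_open_segment_add B0)
    then show False using green_not_both[OF 1] by simp
  qed
  have m\<beta>: "m < 0 \<Longrightarrow> 0 < \<beta>0"
  proof -
    assume "m < 0"
    then have AB: "ab < 0" using AA by (simp add: m_def divide_less_0_iff)
    have "0 < s' * bb * aa" using green' AA BB by simp
    moreover have "s * aa * ab < 0" using green(1) AA AB by (simp add: mult_pos_neg)
    ultimately show "0 < \<beta>0" unfolding \<beta>0_def using det by simp
  qed
  show 1: "\<beta>0 < be y"
  proof (rule ccontr)
    assume n: "\<not> \<beta>0 < be y"
    then have a: "s < be y * m" using not_D aly by simp
    then have m: "0 < m" using green(1,5) by (metis less_trans zero_less_mult_pos)
    have "be y * m \<le> \<beta>0 * m" using n m by simp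
    then show False using hit[OF m a] a by linarith
  qed
  show "0 \<le> \<alpha>0"
  proof (rule ccontr)
    assume "\<not> 0 \<le> \<alpha>0"
    then have n: "s < \<beta>0 * m" using \<alpha>0 by simp
    have m: "0 < m"
    proof (rule ccontr)
      assume "\<not> 0 < m"
      then consider "m = 0" | "m < 0" by linarith
      then show False
      proof cases
        case 1 then show ?thesis using n green(1) by simp
      next
        case 2
        then have "\<beta>0 * m < 0" using m\<beta> by (simp add: mult_pos_neg)
        then show ?thesis using n green(1) by simp
      qed
    qed
    then have "\<beta>0 * m < be y * m" using 1 by simp
    then show False using hit[OF m] n by simp
  qed
qed

text \<open>
  An obstacle that enters the region through the side \<open>uv\<close> or through the line of the first
  green edge on \<open>uv\<close> would have to cross that green edge, or pass behind its end.
\<close>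

lemma no_entry:
  assumes x: "x \<in> P" "x \<noteq> u" "D x" and low: "\<forall>p\<in>P. D p \<longrightarrow> p \<noteq> u \<longrightarrow> f x \<le> f p"
    and cd: "{c, d} \<in> Bl \<union> Gr \<union> R" and r: "r \<in> open_segment c d" "r \<in> open_segment u x"
    and z: "z \<in> open_segment c d" "D z" "f z < f x" and e: "e \<in> {c, d}" "f e \<le> f r"
    and exit: "be z = 0 \<or> k1 z = 0 \<and> k1 e < 0"
  shows False
proof -
  have PP: "c \<in> P" "d \<in> P" "c \<noteq> d" "open_segment c d \<inter> P = {}"
    using cd geo_edgesD[OF geo(1), of c d] geo_edgesD[OF geo(2), of c d] geo_edgesD[OF geo(3), of c d] by auto
  obtain \<tau> where \<tau>: "0 < \<tau>" "\<tau> < 1" "r = (1 - \<tau>) *\<^sub>R u + \<tau> *\<^sub>R x" using r(2) by (auto simp: in_segment)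
  have k1r: "0 < k1 r"
  proof -
    have "k1 u = s * aa" by (simp add: slack_def aa_def)
    then have "0 < (1 - \<tau>) * k1 u" using \<tau> green(1) AA by simp
    moreover have "0 \<le> \<tau> * k1 x" using \<tau> x(3) by (simp add: region_def)
    ultimately show ?thesis unfolding \<tau>(3) affD[OF aff_slack] by simp
  qed
  have not_green: "{c, d} \<noteq> {y0, y}"
  proof
    assume "{c, d} = {y0, y}"
    then have "r \<in> open_segment y0 y" using r(1) by (auto simp: doubleton_eq_iff open_segment_commute)
    then show False using k1_green k1r by auto
  qed
  \<comment> \<open>On the side along uv, a blue or R edge could only be uv itself. A green edge
    cannot cross uv before u + sA, and at u + sA it would meet the first green edge.\<close>
  have side: False if be0: "be z = 0"
  proof -
    have zz: "z = u + al z *\<^sub>R A" using co[of z] be0 by simp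
    have l: "0 \<le> al z" "al z \<le> s"
      using z(2) AA be0 unfolding region_def k1_eq by auto
    have "al z \<noteq> 0" using zz z(1) uP PP(4) by auto
    then have lpos: "0 < al z" "al z < 1" using l green(2) by auto
    then have zuv: "z \<in> open_segment u v" using mem_open_segment_add[OF lpos A0, of u] zz by simp
    consider "{c, d} \<in> Bl \<union> R" | "{c, d} \<in> Gr" using cd by blast
    then show False
    proof cases
      case 1
      then have "{c, d} = {u, v}" using noncrossD[OF nc(1) _ corner(1) z(1) zuv] noncrossD[OF nc(4) _ corner(1) z(1) zuv] by blast
      then have "r \<in> open_segment u v" using r(1) by (auto simp: doubleton_eq_iff open_segment_commute)
      then obtain t where t: "r = (1 - t) *\<^sub>R u + t *\<^sub>R v" by (auto simp: in_segment)
      have "be r = 0" using coord_simps[OF corner(3), of u] unfolding t affD[OF aff_coord2] by simp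
      then have "be x = 0" using coord_simps[OF corner(3), of u] \<tau>(1) unfolding \<tau>(3) affD[OF aff_coord2] by simp
      then have xx: "x = u + al x *\<^sub>R A" and xl: "al x \<le> s" "0 \<le> al x"
        using co[of x] x(3) AA unfolding region_def k1_eq by auto
      have "al x \<noteq> 0" using xx x(2) by auto
      then have "0 < al x" "al x < 1" using xl green(2) by auto
      then have "x \<in> open_segment u (u + A)" by (subst xx) (rule mem_open_segment_add[OF _ _ A0])
      then show False using geo_edgesD(4)[OF geo(1) corner(1)] x(1) by auto
    next
      case 2
      have "s \<le> al z" using green(6) 2 lpos z(1) zz by metis
      then have "al z = s" using l by simp
      then have "z \<in> open_segment y0 y" using zz green(4) by simp
      then show False using noncrossD[OF nc(2) 2 green(3) z(1)] not_green by blast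
    qed
  qed
  show False
  proof (cases "be z = 0")
    case True then show False by (rule side)
  next
    case False
    then have k: "k1 z = 0" "k1 e < 0" and bz: "0 < be z" using exit z(2) by (auto simp: region_def)
    consider "be z < be y" | "be z = be y" | "be y < be z" by linarith
    then show False
    proof cases
      case 1
      have zg: "z \<in> open_segment y0 y" using on_green[OF k(1) _ 1] bz by simp
      consider "{c, d} \<in> Gr \<union> R" | "{c, d} \<in> Bl" using cd by blast
      then show False
      proof cases
        case 1
        then show False using noncrossD[OF nc(2) _ green(3) z(1) zg] noncrossD[OF nc(5) _ green(3) z(1) zg] not_green
          by blast
      next
        case 2
        \<comment> \<open>A blue edge crossing the green one is parallel to A. Its end e beyond the
          perpendicular is therefore deeper than r, against the choice of e.\<close>
        then have o: "(d - c) \<bullet> (y - y0) = 0" using orth green(3) z(1) zg by blast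
        have "cr A (d - c) = 0" using orthogonal_both_zero[OF _ A_orth o] y_ne by blast
        then obtain j where j: "d - c = j *\<^sub>R A" using cr_zero_parallel A0 by blast
        obtain t where t: "r = (1 - t) *\<^sub>R c + t *\<^sub>R d" using r(1) by (auto simp: in_segment)
        have "c - r = (- t) *\<^sub>R (d - c)" "d - r = (1 - t) *\<^sub>R (d - c)" unfolding t by (simp_all add: algebra_simps)
        then obtain l where l: "e - r = l *\<^sub>R A" using e(1) j by (metis insertE scaleR_scaleR singletonD)
        have er: "e = u + (al r + l) *\<^sub>R A + be r *\<^sub>R B"
        proof -
          have "e = r + l *\<^sub>R A" using l by (simp add: algebra_simps)
          also have "\<dots> = u + al r *\<^sub>R A + be r *\<^sub>R B + l *\<^sub>R A" by (subst (1) co[of r]) (rule refl)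
          finally show ?thesis by (simp only: scaleR_add_left add_ac)
        qed
        have ee: "al e = al r + l" "be e = be r"
          by (subst er, rule coord1_eq[OF corner(3)]) (subst er, rule coord2_eq[OF corner(3)])
        have "k1 e = k1 r - l * aa" unfolding k1_eq ee by (simp add: algebra_simps)
        then have "0 < l * aa" using k(2) k1r by simp
        then have "0 < l" using AA by (simp add: zero_less_mult_iff)
        moreover have "f e = f r + norm A * l" unfolding depth_def ee by (simp add: algebra_simps)
        ultimately show False using e(2) A0 by (simp add: mult_le_0_iff)
      qed
    next
      case 2
      then have "z = y" using k(1) k1_green by (intro line_eqI) auto
      then show False using z(1) PP(4) yP by auto
    next
      \<comment> \<open>The obstacle passes behind y. Then y is in the region too, and by
        \<open>f_increasing\<close> it is less deep than z, hence less deep than the minimal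
        x.\<close>
      case 3
      have ky: "k1 y = 0" using k1_green by simp
      have "f y < f z" unfolding f_line[OF k(1)] f_line[OF ky] using 3 f_increasing by simp
      moreover have "D y"
      proof -
        have "0 \<le> al y"
        proof (cases "0 \<le> ab / aa")
          case True
          then have "be y * (ab / aa) \<le> be z * (ab / aa)"
            using 3 by (intro mult_right_mono) auto
          then show ?thesis using z(2) unfolding al_line[OF ky] region_def al_line[OF k(1)] by linarith
        next
          case False
          then have "be y * (ab / aa) \<le> 0" using green(5) by (intro mult_nonneg_nonpos) auto
          then show ?thesis using green(1) unfolding al_line[OF ky] by linarith
        qed
        moreover have "k2 z \<le> k2 y"
          unfolding k2_line[OF ky] k2_line[OF k(1)] using 3 det AA
          by (intro diff_left_mono mult_right_mono) auto
        ultimately show ?thesis using z(2) green(5) ky unfolding region_def by linarith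
      qed
      moreover have "y \<noteq> u" using green(5) coord_simps[OF corner(3), of u] by auto
      ultimately show False using low yP z(3) by fastforce
    qed
  qed
qed

text \<open>One of y and \<open>y'\<close> is in the region. Otherwise both green edges run through
  the meeting point of the perpendiculars; as green edges do not cross, they would be one edge
  perpendicular to both A and B.\<close>

lemma region_inhabited: "\<exists>p\<in>P. D p \<and> p \<noteq> u"
proof -
  interpret S: blue_corner P Bl Gr R u w v y0' y' y0 y s' s by (rule swap)
  have ne: "y \<noteq> u" "y' \<noteq> u"
    using green(5) green'(5) coord_simps[OF corner(3), of u] coord_simps[OF S.corner(3), of u] by auto
  have sw: "S.\<alpha>0 = \<beta>0" "S.\<beta>0 = \<alpha>0"
    unfolding \<alpha>0_def \<beta>0_def S.\<alpha>0_def S.\<beta>0_def aa_def bb_def ab_def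
      S.aa_def S.bb_def S.ab_def inner_commute[of B A] by (simp_all add: mult.commute)
  show ?thesis
  proof (cases "D y \<or> D y'")
    case True then show ?thesis using ne yP S.yP by blast
  next
    case False
    have 1: "\<beta>0 < be y" "0 \<le> \<alpha>0" using leaves_region False by auto
    have 2: "\<alpha>0 < al y'" "0 \<le> \<beta>0"
      using S.leaves_region False unfolding region_swap[of u B A] sw coord2_swap[of u B A] by auto
    define z where "z = u + \<alpha>0 *\<^sub>R A + \<beta>0 *\<^sub>R B"
    have z: "al z = \<alpha>0" "be z = \<beta>0" unfolding z_def by (rule coord1_eq[OF corner(3)], rule coord2_eq[OF corner(3)])
    have k: "k1 z = 0" "k2 z = 0" unfolding k1_eq k2_eq z using meet_A meet_B by simp_all
    have "z \<in> open_segment y0 y" using on_green[OF k(1)] z 1 2 by simp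
    moreover have "z \<in> open_segment y0' y'" using S.on_green[OF k(2)] z 1 2 by (simp add: coord2_swap[of u B A])
    ultimately have "{y0, y} = {y0', y'}" using noncrossD[OF nc(2) green(3) green'(3)] by blast
    then have "B \<bullet> (y - y0) = 0" using S.A_orth by (auto simp: doubleton_eq_iff inner_diff_right)
    then show ?thesis using orthogonal_both_zero[OF corner(3) A_orth] y_ne by blast
  qed
qed

text \<open>A point x of least depth in the region can be joined to u without crossing anything, so
  maximality of R provides the edge. It leaves u strictly inside the angle because uv and uw contain
  no vertices in their interior.\<close>

lemma corner_split:
  assumes max: "\<forall>a\<in>P. \<forall>b\<in>P. a \<noteq> b \<longrightarrow> open_segment a b \<inter> P = {} \<longrightarrow>
    (\<forall>c d. {c, d} \<in> Bl \<union> Gr \<union> R \<longrightarrow> {c, d} \<noteq> {a, b} \<longrightarrow> open_segment c d \<inter> open_segment a b = {}) \<longrightarrow> {a, b} \<in> R"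
  shows "\<exists>x\<in>P. {u, x} \<in> R \<and> 0 < al x \<and> 0 < be x"
proof -
  interpret S: blue_corner P Bl Gr R u w v y0' y' y0 y s' s by (rule swap)
  define Q where "Q = {p \<in> P. D p \<and> p \<noteq> u}"
  have "finite Q" "Q \<noteq> {}" using fin region_inhabited by (auto simp: Q_def)
  then obtain x where x: "x \<in> Q" "\<And>p. p \<in> Q \<Longrightarrow> f x \<le> f p"
    by (metis arg_min_if_finite(1) arg_min_least)
  have xP: "x \<in> P" "x \<noteq> u" "D x" using x(1) by (auto simp: Q_def)
  have low: "\<forall>p\<in>P. D p \<longrightarrow> p \<noteq> u \<longrightarrow> f x \<le> f p" using x(2) by (auto simp: Q_def)
  have pos: "0 < be x"
  proof (rule ccontr)
    assume "\<not> 0 < be x"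
    then have b: "be x = 0" using xP by (simp add: region_def)
    then have xx: "x = u + al x *\<^sub>R A" and xl: "al x \<le> s" "0 \<le> al x"
      using co[of x] xP(3) AA unfolding region_def k1_eq by auto
    have "al x \<noteq> 0" using xx xP(2) by auto
    then have "0 < al x" "al x < 1" using xl green(2) by auto
    then have "x \<in> open_segment u (u + A)" by (subst xx) (rule mem_open_segment_add[OF _ _ A0])
    then show False using geo_edgesD(4)[OF geo(1) corner(1)] xP(1) by auto
  qed
  have pos': "0 < al x"
  proof (rule ccontr)
    assume "\<not> 0 < al x"
    then have b: "al x = 0" using xP by (simp add: region_def)
    then have xx: "x = u + be x *\<^sub>R B" and xl: "be x \<le> s'" "0 \<le> be x"
      using co[of x] xP(3) BB unfolding region_def k2_eq by auto
    have "be x \<noteq> 0" using xx xP(2) by auto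
    then have "0 < be x" "be x < 1" using xl green'(2) by auto
    then have "x \<in> open_segment u (u + B)" by (subst xx) (rule mem_open_segment_add[OF _ _ B0])
    then show False using geo_edgesD(4)[OF geo(1) corner(2)] xP(1) by auto
  qed
  have val: "al u = 0" "be u = 0" using coord_simps[OF corner(3), of u] by auto
  have fu: "f u = 0" using val by (simp add: depth_def)
  have fx: "0 < f x" unfolding depth_def using pos pos' A0 B0 by (simp add: add_pos_pos)
  define \<Phi> where "\<Phi> = {al, be, k1, k2}"
  have D\<Phi>: "D p \<longleftrightarrow> (\<forall>\<phi>\<in>\<Phi>. 0 \<le> \<phi> p)" for p by (auto simp: \<Phi>_def region_def)
  have Du: "D u" using val green(1) green'(1) by (simp add: region_def slack_def)
  have \<Phi>: "finite \<Phi>" "\<forall>\<phi>\<in>\<Phi>. aff \<phi>" by (auto simp: \<Phi>_def intro: aff_slack)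
  have seg: "D p" "f p < f x" if p: "p \<in> open_segment u x" for p
  proof -
    obtain t where t: "0 < t" "t < 1" "p = (1 - t) *\<^sub>R u + t *\<^sub>R x" using open_segment_affine[OF p] .
    have "0 \<le> \<phi> p" if "\<phi> \<in> \<Phi>" for \<phi>
      using \<Phi>(2) that Du xP(3) t unfolding D\<Phi> t(3) by (simp add: affD)
    then show "D p" unfolding D\<Phi> by blast
    show "f p < f x" using fu fx t unfolding t(3) affD[OF aff_depth] by simp
  qed
  have 1: "open_segment u x \<inter> P = {}"
  proof (rule ccontr)
    assume "\<not> ?thesis"
    then obtain p where p: "p \<in> open_segment u x" "p \<in> P" by auto
    then have "p \<noteq> u" by (auto simp: open_segment_def)
    then show False using seg[OF p(1)] low p(2) by force
  qed
  have 2: "open_segment c d \<inter> open_segment u x = {}" if cd: "{c, d} \<in> Bl \<union> Gr \<union> R" "{c, d} \<noteq> {u, x}" for c d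
  proof (rule ccontr)
    assume "\<not> ?thesis"
    then obtain r where r: "r \<in> open_segment c d" "r \<in> open_segment u x" by auto
    have PP: "c \<in> P" "d \<in> P" "open_segment c d \<inter> P = {}"
      using cd geo_edgesD[OF geo(1), of c d] geo_edgesD[OF geo(2), of c d] geo_edgesD[OF geo(3), of c d] by auto
    have F: "\<forall>\<phi>\<in>\<Phi>. 0 \<le> \<phi> u" "\<forall>\<phi>\<in>\<Phi>. 0 \<le> \<phi> x" "f u < f x"
      "\<forall>p\<in>P. (\<forall>\<phi>\<in>\<Phi>. 0 \<le> \<phi> p) \<longrightarrow> p \<noteq> u \<longrightarrow> f x \<le> f p"
      using Du xP(3) low fu fx unfolding D\<Phi> by auto
    obtain e z \<phi> where z: "e \<in> {c, d}" "\<phi> \<in> \<Phi>" "z \<in> open_segment c d" "\<forall>\<psi>\<in>\<Phi>. 0 \<le> \<psi> z"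
      "\<phi> z = 0" "\<phi> e < 0" "f z < f x" "f e \<le> f r"
      by (rule nearest_point_blocked[OF \<Phi> aff_depth F(1,2) xP(1) F(3,4) PP r cd(2)]) blast
    have Dz: "D z" using z(4) unfolding D\<Phi> .
    \<comment> \<open>The four sides of the region form two pairs, one belonging to uv and the other
      to uw; the second pair is the first under \<open>swap\<close>.\<close>
    consider "\<phi> = be \<or> \<phi> = k1" | "\<phi> = al \<or> \<phi> = k2" using z(2) by (auto simp: \<Phi>_def)
    then show False
    proof cases
      case 1
      then show ?thesis using no_entry[OF xP low cd(1) r z(3) Dz z(7,1,8)] z(5,6) by blast
    next
      case 2
      then show ?thesis
        using S.no_entry[unfolded depth_swap[of u B A] region_swap[of u B A] coord2_swap[of u B A],
            OF xP low cd(1) r z(3) Dz z(7,1,8)] z(5,6) by blast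
    qed
  qed
  have "{u, x} \<in> R"
    by (rule max[rule_format, OF uP xP(1) xP(2)[symmetric] 1]) (rule 2)
  then show ?thesis using xP pos pos' by blast
qed

end

subsection \<open>The edge bounds\<close>

lemma edge_segment: "{a, b} = {c, d} \<Longrightarrow> open_segment a b = open_segment c (d::real^2)"
  by (auto simp: doubleton_eq_iff open_segment_commute)

lemma noncross_Un: "noncross S1 S \<Longrightarrow> noncross S2 S \<Longrightarrow> noncross (S1 \<union> S2) S"
  unfolding noncross_def by (meson UnE)

text \<open>A nearest crossing exists since there are finitely many positions. The crossing edge,
  being perpendicular to uv, has ends on both sides of the line uv, and y is the one on the side of
  w.\<close>

lemma first_green:
  assumes fin: "finite P" and geo: "geo_edges P Bl" "geo_edges P Gr"
    and orth: "\<forall>a b c d. {a, b} \<in> Bl \<longrightarrow> {c, d} \<in> Gr \<longrightarrow> open_segment a b \<inter> open_segment c d \<noteq> {} \<longrightarrow>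
      (b - a) \<bullet> (d - c) = 0"
    and uv: "{u, v} \<in> Bl" "cr (v - u) (w - u) \<noteq> 0"
    and hit: "{c0, d0} \<in> Gr" "open_segment u v \<inter> open_segment c0 d0 \<noteq> {}"
  obtains s y0 y where "0 < s" "s < 1" "{y0, y} \<in> Gr" "u + s *\<^sub>R (v - u) \<in> open_segment y0 y"
    "0 < coord2 u (v - u) (w - u) y"
    "\<forall>c d t. {c, d} \<in> Gr \<longrightarrow> 0 < t \<longrightarrow> t < 1 \<longrightarrow> u + t *\<^sub>R (v - u) \<in> open_segment c d \<longrightarrow> s \<le> t"
proof -
  let ?A = "v - u" and ?B = "w - u"
  have A0: "?A \<noteq> 0" using geo_edgesD(3)[OF geo(1) uv(1)] by simp
  have mem: "u + t *\<^sub>R ?A \<in> open_segment u v" if "0 < t" "t < 1" for t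
    using mem_open_segment_add[OF that A0, of u] by simp
  define S where "S = {t. 0 < t \<and> t < 1 \<and> (\<exists>c d. {c, d} \<in> Gr \<and> u + t *\<^sub>R ?A \<in> open_segment c d)}"
  \<comment> \<open>All points of a green edge crossing uv have the same projection to the line uv,
    so the position of the crossing can be read off its end c.\<close>
  have "S \<subseteq> (\<lambda>c. ((c - u) \<bullet> ?A) / (?A \<bullet> ?A)) ` P"
  proof
    fix t assume "t \<in> S"
    then obtain c d where t: "0 < t" "t < 1" and cd: "{c, d} \<in> Gr" "u + t *\<^sub>R ?A \<in> open_segment c d"
      by (auto simp: S_def)
    have o: "?A \<bullet> (d - c) = 0" using orth uv(1) cd mem[OF t] by blast
    obtain \<tau> where "u + t *\<^sub>R ?A = (1 - \<tau>) *\<^sub>R c + \<tau> *\<^sub>R d" using open_segment_affine[OF cd(2)] .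
    then have "c - u = t *\<^sub>R ?A - \<tau> *\<^sub>R (d - c)" by (simp add: algebra_simps)
    then have "(c - u) \<bullet> ?A = t * (?A \<bullet> ?A) - \<tau> * (?A \<bullet> (d - c))"
      by (simp only: inner_diff_left[of "t *\<^sub>R ?A"] inner_scaleR_left inner_commute[of "d - c"])
    then have "t = ((c - u) \<bullet> ?A) / (?A \<bullet> ?A)" unfolding o using A0 by (simp add: field_simps)
    then show "t \<in> (\<lambda>c. ((c - u) \<bullet> ?A) / (?A \<bullet> ?A)) ` P" using geo_edgesD(1)[OF geo(2) cd(1)] by blast
  qed
  then have fS: "finite S" using fin finite_surj by blast
  have "S \<noteq> {}"
  proof -
    obtain q where q: "q \<in> open_segment u v" "q \<in> open_segment c0 d0" using hit by blast
    obtain t where t: "0 < t" "t < 1" "q = (1 - t) *\<^sub>R u + t *\<^sub>R v" using open_segment_affine[OF q(1)] .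
    have "q = u + t *\<^sub>R ?A" unfolding t(3) by (simp add: algebra_simps)
    then show ?thesis using t q(2) hit(1) by (auto simp: S_def)
  qed
  then have Min: "Min S \<in> S" "\<And>t. t \<in> S \<Longrightarrow> Min S \<le> t" using fS by auto
  define s where "s = Min S"
  obtain c d where s: "0 < s" "s < 1" and cd: "{c, d} \<in> Gr" "u + s *\<^sub>R ?A \<in> open_segment c d"
    using Min(1) unfolding s_def[symmetric] by (auto simp: S_def)
  have o: "?A \<bullet> (d - c) = 0" using orth uv(1) cd mem[OF s] by blast
  let ?b = "coord2 u ?A ?B"
  have b0: "?b (u + s *\<^sub>R ?A) = 0" using coord2_eq[OF uv(2), of u s 0] by simp
  have "- ?b c \<noteq> 0 \<or> - ?b d \<noteq> 0"
  proof (rule ccontr)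
    assume "\<not> ?thesis"
    then have "cr ?A (c - u) = 0" "cr ?A (d - u) = 0" using uv(2) by (auto simp: coord2_def)
    then have "cr ?A (d - c) = 0" by (simp add: cr_def algebra_simps)
    then obtain k where k: "d - c = k *\<^sub>R ?A" using cr_zero_parallel A0 by blast
    then have "k * (?A \<bullet> ?A) = 0" using o by simp
    then have "k = 0" using A0 by simp
    then show False using k geo_edgesD(3)[OF geo(2) cd(1)] by simp
  qed
  then obtain y where y: "y \<in> {c, d}" "- ?b y < 0"
    using aff_open_segment_zero_neg[OF aff_uminus[OF aff_coord2] cd(2)] b0 by (metis neg_0_equal_iff_equal)
  define y0 where "y0 = (if y = c then d else c)"
  have e: "{y0, y} = {c, d}" using y(1) by (auto simp: y0_def)
  have seg: "u + s *\<^sub>R ?A \<in> open_segment y0 y" unfolding edge_segment[OF e] by (rule cd(2))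
  show thesis
  proof (rule that[OF s _ seg])
    show "{y0, y} \<in> Gr" using e cd(1) by simp
    show "0 < ?b y" using y(2) by simp
    show "\<forall>c d t. {c, d} \<in> Gr \<longrightarrow> 0 < t \<longrightarrow> t < 1 \<longrightarrow> u + t *\<^sub>R ?A \<in> open_segment c d \<longrightarrow> s \<le> t"
    proof (intro allI impI)
      fix c d t assume "{c, d} \<in> Gr" "0 < t" "t < 1" "u + t *\<^sub>R ?A \<in> open_segment c d"
      then have "t \<in> S" unfolding S_def by blast
      then show "s \<le> t" unfolding s_def by (rule Min(2))
    qed
  qed
qed

text \<open>The maximal plane graph is built in two stages. R is maximal with the green edges among
  its obstacles, as \<open>corner_split\<close> requires; T then completes \<open>Bl\<close> and R
  and may cross green edges.\<close>

lemma crossed_edges_bound: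
  assumes fin: "finite P" and geo: "geo_edges P Bl" "geo_edges P Gr"
    and nc: "noncross Bl Bl" "noncross Gr Gr"
    and orth: "\<forall>a b c d. {a, b} \<in> Bl \<longrightarrow> {c, d} \<in> Gr \<longrightarrow> open_segment a b \<inter> open_segment c d \<noteq> {} \<longrightarrow>
      (b - a) \<bullet> (d - c) = 0"
    and crossed: "\<forall>a b. {a, b} \<in> Bl \<longrightarrow> (\<exists>c d. {c, d} \<in> Gr \<and> open_segment a b \<inter> open_segment c d \<noteq> {})"
    and ne: "Bl \<noteq> {}"
  shows "card Bl + 3 \<le> card P"
proof -
  have F: "geo_edges P {}" "noncross {} {}" "noncross {} (Bl \<union> Gr)" by (auto simp: geo_edges_def noncross_def)
  obtain R where "{} \<subseteq> R" and R: "geo_edges P R" "noncross R R" "noncross R (Bl \<union> Gr)"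
    "\<forall>a\<in>P. \<forall>b\<in>P. a \<noteq> b \<longrightarrow> open_segment a b \<inter> P = {} \<longrightarrow>
       (\<forall>c d. {c, d} \<in> Bl \<union> Gr \<union> R \<longrightarrow> {c, d} \<noteq> {a, b} \<longrightarrow> open_segment c d \<inter> open_segment a b = {}) \<longrightarrow> {a, b} \<in> R"
    using maximal_noncross[OF fin F] .
  have RB: "noncross R Bl" "noncross R Gr" using R(3) unfolding noncross_def by (meson UnI1 UnI2)+
  have 1: "noncross (Bl \<union> R) (Bl \<union> R)"
    by (intro noncross_Un noncross_Un[THEN noncross_sym] nc(1) R(2) RB(1) noncross_sym[OF RB(1)])
  have 2: "geo_edges P (Bl \<union> R)" using geo(1) R(1) unfolding geo_edges_def by blast
  obtain T where T: "Bl \<union> R \<subseteq> T" "max_plane P T" using max_plane_extend[OF fin 2 1] .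
  have T2: "geo_edges P T" "noncross T T" using T by (auto simp: max_plane_def)
  \<comment> \<open>The R edge provided by \<open>corner_split\<close> belongs to T and would enter
    the corner of an empty triangle of T.\<close>
  have no_two: False
    if uv: "{u, v} \<in> Bl" "{u, w} \<in> Bl" and t: "{v, u, w} \<in> triangles P T" for u v w
  proof -
    note t1 = trianglesD[OF t]
    have c': "cr (w - u) (v - u) \<noteq> 0" using t1(4) cr_commute[of "v - u" "w - u"] by simp
    obtain c d where 1: "{c, d} \<in> Gr" "open_segment u v \<inter> open_segment c d \<noteq> {}" using crossed uv(1) by blast
    obtain s y0 y where g: "0 < s" "s < 1" "{y0, y} \<in> Gr" "u + s *\<^sub>R (v - u) \<in> open_segment y0 y"
      "0 < coord2 u (v - u) (w - u) y"
      "\<forall>c d t. {c, d} \<in> Gr \<longrightarrow> 0 < t \<longrightarrow> t < 1 \<longrightarrow> u + t *\<^sub>R (v - u) \<in> open_segment c d \<longrightarrow> s \<le> t"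
      using first_green[OF fin geo orth uv(1) t1(4) 1] by metis
    obtain c d where 2: "{c, d} \<in> Gr" "open_segment u w \<inter> open_segment c d \<noteq> {}" using crossed uv(2) by blast
    obtain s' y0' y' where g': "0 < s'" "s' < 1" "{y0', y'} \<in> Gr" "u + s' *\<^sub>R (w - u) \<in> open_segment y0' y'"
      "0 < coord2 u (w - u) (v - u) y'"
      "\<forall>c d t. {c, d} \<in> Gr \<longrightarrow> 0 < t \<longrightarrow> t < 1 \<longrightarrow> u + t *\<^sub>R (w - u) \<in> open_segment c d \<longrightarrow> s' \<le> t"
      using first_green[OF fin geo orth uv(2) c' 2] by metis
    interpret blue_corner P Bl Gr R u v w y0 y y0' y' s s'
      by unfold_locales (fact fin geo R nc RB orth uv t1(4) g g')+
    obtain x where x: "x \<in> P" "{u, x} \<in> R" "0 < coord1 u (v - u) (w - u) x" "0 < coord2 u (v - u) (w - u) x"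
      using corner_split[OF R(4)] by blast
    have "{u, x} \<in> T" using x(2) T(1) by blast
    then show False
      using corner_empty[OF T2(2) t1(7,8,4) _ x(1) coords[OF t1(4)] x(3,4)] by blast
  qed
  have one: "card {e \<in> Bl. e \<subseteq> t} \<le> 1" if t: "t \<in> triangles P T" for t
  proof (rule ccontr)
    assume "\<not> ?thesis"
    then have "1 < card {e \<in> Bl. e \<subseteq> t}" by simp
    then have "\<exists>e e'. e \<in> {e \<in> Bl. e \<subseteq> t} \<and> e' \<in> {e \<in> Bl. e \<subseteq> t} \<and> e \<noteq> e'"
      by (metis (no_types, lifting) One_nat_def card_le_Suc0_iff_eq card.infinite less_zeroE not_less)
    then obtain e e' where e: "e \<in> Bl" "e' \<in> Bl" "e \<subseteq> t" "e' \<subseteq> t" "e \<noteq> e'" by auto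
    obtain a b where ab: "e = {a, b}" "a \<noteq> b" using e(1) geo(1) unfolding geo_edges_def by blast
    obtain c d where cd: "e' = {c, d}" "c \<noteq> d" using e(2) geo(1) unfolding geo_edges_def by blast
    have t3: "card t = 3" "finite t" using t by (auto simp: triangles_def intro: card_ge_0_finite)
    have "card (t - e) = 1" using t3 e(3) ab by (simp add: card_Diff_subset)
    then obtain z where z: "t - e = {z}" by (auto simp: card_1_singleton_iff)
    then have tt: "t = {a, b, z}" "z \<noteq> a" "z \<noteq> b" using e(3) ab by auto
    have "e' = {a, z} \<or> e' = {b, z}" using e(4,5) ab cd tt by auto
    then show False
    proof
      assume "e' = {a, z}"
      moreover have "t = {b, a, z}" using tt by auto
      ultimately show False using no_two[of a b z] e(1,2) ab t by auto
    next
      assume "e' = {b, z}"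
      then show False using no_two[of b a z] e(1,2) ab t tt by (auto simp: insert_commute)
    qed
  qed
  \<comment> \<open>The perpendicular edge that crosses uv has an end on either side of it, so all
    darts of \<open>Bl\<close> are inner.\<close>
  have sides: "\<exists>x\<in>P. 0 < cr (v - u) (x - u)" if uv: "{u, v} \<in> Bl" for u v
  proof -
    obtain c d q where cd: "{c, d} \<in> Gr" and q: "q \<in> open_segment u v" "q \<in> open_segment c d"
      using crossed uv by blast
    then have o: "(v - u) \<bullet> (d - c) = 0" using orth uv by blast
    define h where "h x = cr (v - u) (x - u)" for x
    have h: "aff h" unfolding h_def by (rule aff_cr2)
    have "h u = 0" "h v = 0" by (auto simp: h_def cr_def)
    then have hq: "h q = 0" using q(1) by (elim aff_open_segment[OF h]) auto
    have v0: "v - u \<noteq> 0" using geo_edgesD(3)[OF geo(1) uv] by simp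
    have "- h c \<noteq> 0 \<or> - h d \<noteq> 0"
    proof (rule ccontr)
      assume "\<not> ?thesis"
      then have "cr (v - u) (d - c) = 0" by (simp add: h_def cr_def algebra_simps)
      then obtain k where k: "d - c = k *\<^sub>R (v - u)" using cr_zero_parallel v0 by blast
      then have "k * ((v - u) \<bullet> (v - u)) = 0" using o by simp
      then have "k = 0" using v0 by simp
      then show False using k geo_edgesD(3)[OF geo(2) cd] by simp
    qed
    then obtain y where "y \<in> {c, d}" "- h y < 0"
      using aff_open_segment_zero_neg[OF aff_uminus[OF h] q(2)] hq by (metis neg_0_equal_iff_equal)
    then show ?thesis using geo_edgesD(1,2)[OF geo(2) cd] by (auto simp: h_def)
  qed
  then have inner: "inner_darts P Bl = darts Bl" by (auto simp: inner_darts_def darts_def)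
  have "Bl \<subseteq> T" using T(1) by blast
  then have "card (inner_darts P Bl) \<le> 1 * card (triangles P T)"
    using inner_dart_count[OF fin T(2)] one by blast
  then have count: "2 * card Bl \<le> card (triangles P T)"
    using card_darts(2)[OF geo_edges_finite[OF fin geo(1)] geo(1)] by (simp add: inner)
  obtain N :: "real^2" where N: "inj_on (\<lambda>x. N \<bullet> x) P" using generic_direction[OF fin] .
  obtain e where e: "e \<in> Bl" using ne by blast
  then obtain u v where "e = {u, v}" using geo(1) unfolding geo_edges_def by blast
  then have uv: "{u, v} \<in> Bl" using e by simp
  obtain x where x: "x \<in> P" "0 < cr (v - u) (x - u)" using sides[OF uv] by blast
  have P: "u \<in> P" "v \<in> P" using geo_edgesD[OF geo(1) uv] by auto
  obtain p where p: "p \<in> P" "\<forall>x\<in>P. N \<bullet> p \<le> N \<bullet> x"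
    using finite_attains_max[OF fin, of "\<lambda>x. - (N \<bullet> x)"] P by force
  have "3 \<le> card (free_slots N P T p)"
    by (rule three_free_slots[OF fin T2 N p P x(1)]) (use x(2) in simp)
  moreover have "card (triangles P T) + card (free_slots N P T p) \<le> 2 * (card P - 1)"
    by (rule slot_count[OF fin T2 N p])
  \<comment> \<open>From 2|Bl| \<le> 2(n - 1) - 3 = 2n - 5, an odd number, |Bl| \<le> n - 3.\<close>
  ultimately show ?thesis using count by linarith
qed

text \<open>The product of the coordinates does not see the sign of d, so the colour belongs to the
  undirected edge. Of the two axes exactly one is blue.\<close>

definition blue_direction :: "real^2 \<Rightarrow> bool" where
  "blue_direction d \<longleftrightarrow> 0 < d$1 * d$2 \<or> d$2 = 0"

lemma blue_direction_minus: "blue_direction (a - b) = blue_direction (b - a)"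
  by (auto simp: blue_direction_def algebra_simps)

text \<open>A turn by a right angle reverses the sign of the product of the coordinates and
  exchanges the axes.\<close>

lemma blue_direction_orthogonal:
  assumes "d \<bullet> d' = 0" "d \<noteq> 0" "d' \<noteq> 0"
  shows "blue_direction d \<noteq> blue_direction d'"
proof -
  have "cr (perp d) d' = 0" using assms(1) by (simp add: cr_def perp_def inner_2 algebra_simps)
  moreover have "perp d \<noteq> 0" using assms(2) by (auto simp: perp_def vec_eq_iff forall_2)
  ultimately obtain k where k: "d' = k *\<^sub>R perp d" using cr_zero_parallel by blast
  have k0: "0 < k * k" using k assms(3) by (auto simp: zero_less_mult_iff)
  have eq: "d' $ 1 * d' $ 2 = - (k * k * (d$1 * d$2))" unfolding k by (simp add: perp_def)
  have pos: "0 < d' $ 1 * d' $ 2 \<longleftrightarrow> d$1 * d$2 < 0" unfolding eq using k0 by (simp add: mult_less_0_iff)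
  have zero: "d' $ 2 = 0 \<longleftrightarrow> d$1 = 0" unfolding k using k0 by (auto simp: perp_def)
  have "d$1 \<noteq> 0 \<or> d$2 \<noteq> 0" using assms(2) by (auto simp: vec_eq_iff forall_2)
  then show ?thesis unfolding blue_direction_def pos zero
    by (auto simp: zero_less_mult_iff mult_less_0_iff)
qed

lemma plane_RAC_bound:
  fixes col :: "real^2 \<Rightarrow> bool"
  assumes P: "finite P" "3 \<le> card P" and E: "geo_edges P E"
    and orth: "\<And>a b c d. {a, b} \<in> E \<Longrightarrow> {c, d} \<in> E \<Longrightarrow> {a, b} \<noteq> {c, d} \<Longrightarrow>
      open_segment a b \<inter> open_segment c d \<noteq> {} \<Longrightarrow> (b - a) \<bullet> (d - c) = 0"
    and col: "\<And>u v. {u, v} \<in> E \<Longrightarrow> col u \<noteq> col v"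
  shows "card E + 7 \<le> 3 * card P"
proof -
  define H where "H = {e \<in> E. \<forall>a b. e = {a, b} \<longrightarrow> blue_direction (b - a)}"
  have H: "{a, b} \<in> H \<longleftrightarrow> {a, b} \<in> E \<and> blue_direction (b - a)" for a b
    using blue_direction_minus[of a b] by (auto simp: H_def doubleton_eq_iff)
  \<comment> \<open>The crossing partner may be any edge of E; by \<open>hue\<close> it is then
    outside H.\<close>
  define Bl where "Bl = {e \<in> H. \<exists>a b c d. e = {a, b} \<and> {c, d} \<in> E \<and> {a, b} \<noteq> {c, d} \<and>
    open_segment a b \<inter> open_segment c d \<noteq> {}}"
  have hue: "({a, b} \<in> H) \<noteq> ({c, d} \<in> H)"
    if "{a, b} \<in> E" "{c, d} \<in> E" "{a, b} \<noteq> {c, d}" "open_segment a b \<inter> open_segment c d \<noteq> {}" for a b c d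
    using blue_direction_orthogonal[OF orth[OF that]] geo_edgesD(3)[OF E that(1)] geo_edgesD(3)[OF E that(2)] that(1,2)
    by (simp add: H)
  have sub: "Bl \<subseteq> H" "H \<subseteq> E" by (auto simp: Bl_def H_def)
  have fE: "finite E" using geo_edges_finite[OF P(1) E] .
  have geo: "geo_edges P Bl" "geo_edges P (E - H)" "geo_edges P (E - Bl)" using E sub unfolding geo_edges_def by blast+
  have ncB: "noncross Bl Bl"
    unfolding noncross_def using hue sub by blast
  have ncG: "noncross (E - H) (E - H)"
    unfolding noncross_def using hue by blast
  have ncR: "noncross (E - Bl) (E - Bl)"
    unfolding noncross_def
  proof (intro allI impI, rule ccontr)
    fix a b c d assume *: "{a, b} \<in> E - Bl" "{c, d} \<in> E - Bl" "{a, b} \<noteq> {c, d}" "open_segment a b \<inter> open_segment c d \<noteq> {}"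
    then have "{a, b} \<in> H \<or> {c, d} \<in> H" using hue[of a b c d] by blast
    then have "{a, b} \<in> Bl \<or> {c, d} \<in> Bl" using * unfolding Bl_def by blast
    then show False using * by blast
  qed
  have "card (E - Bl) + 4 \<le> 2 * card P"
    by (rule plane_bipartite_bound[OF P geo(3) ncR, where col = col]) (use col in blast)
  moreover have "card E = card (E - Bl) + card Bl"
    using fE sub by (metis card_Diff_subset card_mono finite_subset le_add_diff_inverse2 order_trans)
  \<comment> \<open>If there are crossed blue edges, (2n - 4) + (n - 3) = 3n - 7. If there are none,
    2n - 4 \<le> 3n - 7 because n \<ge> 3.\<close>
  moreover have "card Bl = 0 \<or> card Bl + 3 \<le> card P"
  proof (cases "Bl = {}")
    case False
    have "card Bl + 3 \<le> card P"
    proof (rule crossed_edges_bound[OF P(1) geo(1,2) ncB ncG _ _ False])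
      show "\<forall>a b c d. {a, b} \<in> Bl \<longrightarrow> {c, d} \<in> E - H \<longrightarrow> open_segment a b \<inter> open_segment c d \<noteq> {} \<longrightarrow>
        (b - a) \<bullet> (d - c) = 0"
      proof (intro allI impI)
        fix a b c d assume *: "{a, b} \<in> Bl" "{c, d} \<in> E - H" "open_segment a b \<inter> open_segment c d \<noteq> {}"
        then have "{a, b} \<noteq> {c, d}" "{a, b} \<in> E" "{c, d} \<in> E" using sub by auto
        then show "(b - a) \<bullet> (d - c) = 0" using orth *(3) by blast
      qed
      show "\<forall>a b. {a, b} \<in> Bl \<longrightarrow> (\<exists>c d. {c, d} \<in> E - H \<and> open_segment a b \<inter> open_segment c d \<noteq> {})"
      proof (intro allI impI)
        fix a b assume ab: "{a, b} \<in> Bl"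
        then obtain a' b' c d where *: "{a, b} = {a', b'}" "{c, d} \<in> E" "{a', b'} \<noteq> {c, d}"
          "open_segment a' b' \<inter> open_segment c d \<noteq> {}" "{a, b} \<in> H" unfolding Bl_def by blast
        have "{c, d} \<notin> H" using hue[OF _ *(2,3,4)] *(1,5) sub by auto
        then show "\<exists>c d. {c, d} \<in> E - H \<and> open_segment a b \<inter> open_segment c d \<noteq> {}"
          unfolding edge_segment[OF *(1)] using *(2,4) by blast
      qed
    qed
    then show ?thesis ..
  qed simp
  ultimately show ?thesis using P(2) by linarith
qed

theorem theorem6:
  fixes V :: "'a set" and E :: "'a set set" and n :: nat
  assumes "n \<ge> 3"
    and "RAC_graph V E"
    and "bipartite V E"
    and "card V = n"
  shows "card E \<le> 3 * n - 7"
proof -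
  obtain p where p: "RAC_drawing V E p" and simple: "simple_graph V E"
    using assms(2) by (auto simp: RAC_graph_def)
  have inj: "inj_on p V"
    and avoid: "\<And>u v w. {u, v} \<in> E \<Longrightarrow> w \<in> V - {u, v} \<Longrightarrow> p w \<notin> closed_segment (p u) (p v)"
    and right: "\<And>a b c d. {a, b} \<in> E \<Longrightarrow> {c, d} \<in> E \<Longrightarrow> {a, b} \<noteq> {c, d} \<Longrightarrow>
        open_segment (p a) (p b) \<inter> open_segment (p c) (p d) \<noteq> {} \<Longrightarrow> orthogonal (p b - p a) (p d - p c)"
    using p unfolding RAC_drawing_def straight_line_drawing_def by blast+
  have fV: "finite V" and EV: "\<And>e. e \<in> E \<Longrightarrow> e \<subseteq> V \<and> card e = 2" using simple by (auto simp: simple_graph_def)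
  \<comment> \<open>Vertices are replaced by their positions. Injectivity of p preserves the number
    of edges and carries the bipartition over to points.\<close>
  define E' where "E' = (`) p ` E"
  have lift: "\<exists>a b. {a, b} \<in> E \<and> a \<in> V \<and> b \<in> V \<and> a \<noteq> b \<and> x = p a \<and> y = p b" if xy: "{x, y} \<in> E'" for x y
  proof -
    obtain e where e: "{x, y} = p ` e" "e \<in> E" using xy unfolding E'_def by (rule imageE)
    obtain a b where ab: "e = {a, b}" "a \<noteq> b" using EV[OF e(2)] by (auto simp: card_2_iff)
    then have "x = p a \<and> y = p b \<or> x = p b \<and> y = p a" using e(1) by (auto simp: doubleton_eq_iff)
    moreover have "{a, b} \<in> E" "{b, a} \<in> E" using ab(1) e(2) by (auto simp: insert_commute)
    moreover have "a \<in> V" "b \<in> V" using EV[OF e(2)] ab(1) by auto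
    ultimately show ?thesis using ab(2) by metis
  qed
  have "geo_edges (p ` V) E'"
    unfolding geo_edges_def
  proof
    fix e' assume "e' \<in> E'"
    then obtain e where e: "e' = p ` e" "e \<in> E" unfolding E'_def by (rule imageE)
    obtain a b where ab: "e = {a, b}" "a \<noteq> b" using EV[OF e(2)] by (auto simp: card_2_iff)
    have V: "a \<in> V" "b \<in> V" using EV[OF e(2)] ab by auto
    have "open_segment (p a) (p b) \<inter> p ` V = {}"
      using avoid[of a b] e(2) ab by (fastforce simp: open_segment_def)
    moreover have "p a \<noteq> p b" using inj V ab by (auto simp: inj_on_def)
    ultimately show "\<exists>a b. e' = {a, b} \<and> a \<in> p ` V \<and> b \<in> p ` V \<and> a \<noteq> b \<and> open_segment a b \<inter> p ` V = {}"
      using V e(1) ab by auto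
  qed
  moreover have "(y - x) \<bullet> (w - z) = 0"
    if xy: "{x, y} \<in> E'" and zw: "{z, w} \<in> E'" and ne: "{x, y} \<noteq> {z, w}"
      and X: "open_segment x y \<inter> open_segment z w \<noteq> {}" for x y z w
  proof -
    obtain a b where ab: "{a, b} \<in> E" "x = p a" "y = p b" using lift[OF xy] by blast
    obtain c d where cd: "{c, d} \<in> E" "z = p c" "w = p d" using lift[OF zw] by blast
    have "{a, b} \<noteq> {c, d}" using ne ab cd by (auto simp: doubleton_eq_iff)
    then show ?thesis using right[OF ab(1) cd(1)] X unfolding ab(2,3) cd(2,3) orthogonal_def by blast
  qed
  moreover obtain X Y where XY: "X \<union> Y = V" "X \<inter> Y = {}" "\<And>e. e \<in> E \<Longrightarrow> \<exists>a\<in>X. \<exists>b\<in>Y. e = {a, b}"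
    using assms(3) unfolding bipartite_def by metis
  have "(x \<in> p ` X) \<noteq> (y \<in> p ` X)" if xy: "{x, y} \<in> E'" for x y
  proof -
    have image: "p a \<in> p ` X \<longleftrightarrow> a \<in> X" if "a \<in> V" for a
      using inj_on_image_mem_iff[OF inj that] XY(1) by blast
    obtain a b where ab: "{a, b} \<in> E" "a \<in> V" "b \<in> V" "x = p a" "y = p b" using lift[OF xy] by blast
    obtain a' b' where "a' \<in> X" "b' \<in> Y" "{a, b} = {a', b'}" using XY(3)[OF ab(1)] by blast
    then have "(a \<in> X) \<noteq> (b \<in> X)" using XY(2) by (auto simp: doubleton_eq_iff)
    then show ?thesis using ab image by simp
  qed
  moreover have "card (p ` V) = n" using card_image[OF inj] assms(4) by simp
  \<comment> \<open>The additive form rules out any effect of truncated subtraction on natural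
    numbers.\<close>
  ultimately have "card E' + 7 \<le> 3 * n"
    using plane_RAC_bound[of "p ` V" E' "\<lambda>x. x \<in> p ` X"] fV assms(1) by simp
  moreover have "card E' = card E"
    unfolding E'_def using EV inj by (intro card_image inj_on_subset[OF inj_on_image_Pow]) auto
  ultimately show ?thesis by simp
qed

end
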